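(* Let $k\ge1$ be an integer. For $s=0,1,2$ the spaces of traces of $\mathcal U^{(s),k}(\Omega)$ on the faces of the pyramid are the same as those of the corresponding tetrahedral and hexahedral elements: for every triangular face $S_{i,\Omega}$, $i=1,2,3,4$, and the base face $B_\Omega$, $$\Gamma^s_{i,\Omega}\,\mathcal U^{(s),k}(\Omega)=\tau^{(s),k}\qquad\text{and}\qquad \Gamma^s_{B,\Omega}\,\mathcal U^{(s),k}(\Omega)=\sigma^{(s),k}.$$
   Context: Finite pyramid: $\Omega=\{(\xi,\eta,\zeta)\in\mathbb R^3:\xi,\eta,\zeta\ge0,\ \xi\le1-\zeta,\ \eta\le1-\zeta\}$, with base $B_\Omega=\Omega\cap\{\zeta=0\}$ and triangular faces $S_{1,\Omega},\dots,S_{4,\Omega}$ in the planes $\eta=0$, $\xi=1-\zeta$, $\eta=1-\zeta$, $\xi=0$. Infinite pyramid: $\Omega_\infty=\{(x,y,z): 0\le x,y\le1,\ z\ge0\}$ (together with a point $\infty$). Map: $\phi:\Omega_\infty\to\Omega$, $\phi(x,y,z)=\left(\frac{x}{1+z},\frac{y}{1+z},\frac{z}{1+z}\right)$, a diffeomorphism onto $\Omega$ minus its apex $(0,0,1)$. Pullbacks: 0-forms $\phi^*u=u\circ\phi$; 1-forms $\phi^*E=D\phi^T(E\circ\phi)$; 2-forms $\phi^*v=|D\phi|D\phi^{-1}(v\circ\phi)$, $|D\phi|$ being the Jacobian determinant; $(\phi^{-1})^*=(\phi^* )^{-1}$. Traces: $\Gamma^s_{i,\Omega}$ and $\Gamma^s_{B,\Omega}$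 are the pullbacks of $s$-forms under the inclusions of $S_{i,\Omega}$ and $B_\Omega$ in $\Omega$: restriction for $s=0$, the tangential components for $s=1$, the normal component for $s=2$. They are expressed in the coordinates $(\xi,\zeta)$ on $S_{1,\Omega},S_{3,\Omega}$, $(\eta,\zeta)$ on $S_{2,\Omega},S_{4,\Omega}$, and $(\xi,\eta)$ on $B_\Omega$. The target spaces, in face coordinates $(\xi,\zeta)$ (resp. $(\eta,\zeta)$) for $\tau$ and $(\xi,\eta)$ for $\sigma$, are $\tau^{(0),k}=P^k$, $\tau^{(1),k}=(P^{k-1})^2\oplus S^{k,2}$, $\tau^{(2),k}=P^{k-1}$; $\sigma^{(0),k}=Q^{k,k}$, $\sigma^{(1),k}=Q^{k-1,k}\times Q^{k,k-1}$, $\sigma^{(2),k}=Q^{k-1,k-1}$. Here $P^n$ is the space of polynomials of total degree $\le n$, $Q^{m,n}$ that of polynomials of degree $\le m$ and $\le n$ in the first and second variable, and $S^{k,2}=\{w\in(\tilde P^k)^2:(\xi-\xi_0,\zeta-\zeta_0)\cdot w=0\}$ with $\tilde P^k$ the homogeneous polynomials of degree $k$ in $(\xi-\xi_0,\zeta-\zeta_0)$, for some fixed point $(\xi_0,\zeta_0)$ (the sum $(P^{k-1})^2\oplus S^{k,2}$ does not depend on this point). Spaces: $Q^{l,m,n}$: polynomials of degree at most $l,m,n$ in $x,y,z$; $Q^{l,m,n}_k=\{u/(1+z)^k:u\in Q^{l,m,n}\}$; $P^n_k[w,z]=\{u(w,z)/(1+z)^k:u$ polynomial of total degree $\le n\}$;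 $\tilde P^{k-1}_{k+1}[w,1+z]=\frac{1}{(1+z)^{k+1}}\mathrm{span}\{w^a(1+z)^{k-1-a}:0\le a\le k-1\}$. Polynomial spaces with a negative degree are $\{0\}$. Subscripts $x,y$ on $r,s,t$ denote partial derivatives. $\mathcal U^{(0),k}(\Omega_\infty)$: all $u\in Q_k^{k,k,k-1}\oplus\mathrm{span}\{z^k/(1+z)^k\}$ whose restrictions to $y=0,1$ lie in $P_k^k[x,z]$ and to $x=0,1$ lie in $P_k^k[y,z]$. $\mathcal U^{(1),k}(\Omega_\infty)$: all $u\in Q_{k+1}^{k-1,k,k-1}\times Q_{k+1}^{k,k-1,k-1}\times Q_{k+1}^{k,k,k-2}\oplus\{\frac{z^{k-1}}{(1+z)^{k+1}}(r_xz,r_yz,-r)^T:r\in Q^{k,k}[x,y]\}$ such that on $y=0,1$ (with $w=x$) $(u_1,u_3)\in(P^{k-1}_{k+1}[w,z])^2\oplus\tilde P^{k-1}_{k+1}[w,1+z](1+z,-w)^T$, and on $x=0,1$ (with $w=y$) $(u_2,u_3)$ lies in the same space. $\mathcal U^{(2),k}(\Omega_\infty)$: all $u\in Q_{k+2}^{k,k-1,k-2}\times Q_{k+2}^{k-1,k,k-2}\times Q_{k+2}^{k-1,k-1,k-1}\oplus\{\frac{z^{k-1}}{(1+z)^{k+2}}(0,2s,s_y(1+z))^T:s\in Q^{k-1,k}[x,y]\}\oplus\{\frac{z^{k-1}}{(1+z)^{k+2}}(2t,0,t_x(1+z))^T:t\in Q^{k,k-1}[x,y]\}$ whose normal components lie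 in $P^{k-1}_{k+2}[x,z]$ on $y=0,1$ and in $P^{k-1}_{k+2}[y,z]$ on $x=0,1$. $\mathcal U^{(s),k}(\Omega)=(\phi^{-1})^*\mathcal U^{(s),k}(\Omega_\infty)$, using the pullback of $s$-forms. *)

theory Defs
  imports "HOL-Analysis.Analysis"
begin

text \<open>
  Elements of the element spaces are functions on the pyramid without its apex, or on the
  infinite pyramid.  They are represented by total functions whose values off that domain
  are irrelevant: \<open>agreeing D A\<close> is the set of functions that coincide on \<open>D\<close> with a
  member of \<open>A\<close>.
\<close>

definition agreeing :: "'a set \<Rightarrow> ('a \<Rightarrow> 'b) set \<Rightarrow> ('a \<Rightarrow> 'b) set" where
  "agreeing D A = {f. \<exists>g\<in>A. \<forall>p\<in>D. f p = g p}"

text \<open>Only the underlying sum of a direct sum; directness is not part of the definition.\<close>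

definition sum_space :: "('a \<Rightarrow> 'b::plus) set \<Rightarrow> ('a \<Rightarrow> 'b) set \<Rightarrow> ('a \<Rightarrow> 'b) set"
    (infixl "\<oplus>\<^sub>F" 65) where
  "A \<oplus>\<^sub>F B = {\<lambda>p. f p + g p | f g. f \<in> A \<and> g \<in> B}"

definition pair_space :: "('a \<Rightarrow> real) set \<Rightarrow> ('a \<Rightarrow> real) set \<Rightarrow> ('a \<Rightarrow> real^2) set" where
  "pair_space A B = {\<lambda>p. vector [f p, g p] | f g. f \<in> A \<and> g \<in> B}"

definition triple_space ::
    "('a \<Rightarrow> real) set \<Rightarrow> ('a \<Rightarrow> real) set \<Rightarrow> ('a \<Rightarrow> real) set \<Rightarrow> ('a \<Rightarrow> real^3) set" where
  "triple_space A B C = {\<lambda>p. vector [f p, g p, h p] | f g h. f \<in> A \<and> g \<in> B \<and> h \<in> C}"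

text \<open>Degree bounds are integers; a negative bound gives an empty sum, i.e. the zero space.\<close>

definition P2 :: "int \<Rightarrow> (real^2 \<Rightarrow> real) set" where
  "P2 n = {\<lambda>q. \<Sum>(i, j)\<in>{(i, j). int i + int j \<le> n}. c i j * q$1 ^ i * q$2 ^ j | c. True}"

definition Q2 :: "int \<Rightarrow> int \<Rightarrow> (real^2 \<Rightarrow> real) set" where
  "Q2 m n = {\<lambda>q. \<Sum>i | int i \<le> m. \<Sum>j | int j \<le> n. c i j * q$1 ^ i * q$2 ^ j | c. True}"

definition Q3 :: "int \<Rightarrow> int \<Rightarrow> int \<Rightarrow> (real^3 \<Rightarrow> real) set" where
  "Q3 l m n = {\<lambda>p. \<Sum>h | int h \<le> l. \<Sum>i | int i \<le> m. \<Sum>j | int j \<le> n.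
      c h i j * p$1 ^ h * p$2 ^ i * p$3 ^ j | c. True}"

definition hom_poly :: "real^2 \<Rightarrow> nat \<Rightarrow> (real^2 \<Rightarrow> real) set" where
  "hom_poly q0 n = {\<lambda>q. \<Sum>i\<le>n. c i * (q$1 - q0$1) ^ i * (q$2 - q0$2) ^ (n - i) | c. True}"

text \<open>The denominator is a power of \<open>1 + z\<close> with \<open>z\<close> the last coordinate.\<close>

definition Q3w :: "nat \<Rightarrow> int \<Rightarrow> int \<Rightarrow> int \<Rightarrow> (real^3 \<Rightarrow> real) set" where
  "Q3w k l m n = {\<lambda>p. f p / (1 + p$3) ^ k | f. f \<in> Q3 l m n}"

definition P2w :: "nat \<Rightarrow> int \<Rightarrow> (real^2 \<Rightarrow> real) set" where
  "P2w k n = {\<lambda>q. f q / (1 + q$2) ^ k | f. f \<in> P2 n}"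

definition hom_w :: "nat \<Rightarrow> nat \<Rightarrow> (real^2 \<Rightarrow> real) set" where
  "hom_w k n = {\<lambda>q. (\<Sum>a\<le>n. c a * q$1 ^ a * (1 + q$2) ^ (n - a)) / (1 + q$2) ^ k | c. True}"

definition Omega :: "(real^3) set" where
  "Omega = {p. 0 \<le> p$1 \<and> 0 \<le> p$2 \<and> 0 \<le> p$3 \<and> p$1 \<le> 1 - p$3 \<and> p$2 \<le> 1 - p$3}"

definition apex :: "real^3" where
  "apex = vector [0, 0, 1]"

definition Omega_inf :: "(real^3) set" where
  "Omega_inf = {p. 0 \<le> p$1 \<and> p$1 \<le> 1 \<and> 0 \<le> p$2 \<and> p$2 \<le> 1 \<and> 0 \<le> p$3}"

definition phi :: "real^3 \<Rightarrow> real^3" where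
  "phi p = vector [p$1 / (1 + p$3), p$2 / (1 + p$3), p$3 / (1 + p$3)]"

definition pullback0 :: "(real^3 \<Rightarrow> real) \<Rightarrow> real^3 \<Rightarrow> real" where
  "pullback0 u = (\<lambda>p. u (phi p))"

definition pullback1 :: "(real^3 \<Rightarrow> real^3) \<Rightarrow> real^3 \<Rightarrow> real^3" where
  "pullback1 E = (\<lambda>p. transpose (jacobian phi (at p)) *v E (phi p))"

definition pullback2 :: "(real^3 \<Rightarrow> real^3) \<Rightarrow> real^3 \<Rightarrow> real^3" where
  "pullback2 v = (\<lambda>p. det (jacobian phi (at p)) *\<^sub>R
     (matrix_inv (jacobian phi (at p)) *v v (phi p)))"

text \<open>
  \<open>inf_face\<close> is the common coordinate domain \<open>{(w, z)}\<close> of the vertical faces of the infinite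
  pyramid; \<open>face_y c\<close> and \<open>face_x c\<close> parametrize the faces \<open>y = c\<close> and \<open>x = c\<close>.
\<close>

definition inf_face :: "(real^2) set" where
  "inf_face = {q. 0 \<le> q$1 \<and> q$1 \<le> 1 \<and> 0 \<le> q$2}"

definition face_y :: "real \<Rightarrow> real^2 \<Rightarrow> real^3" where
  "face_y c q = vector [q$1, c, q$2]"

definition face_x :: "real \<Rightarrow> real^2 \<Rightarrow> real^3" where
  "face_x c q = vector [c, q$1, q$2]"

definition U0_inf :: "nat \<Rightarrow> (real^3 \<Rightarrow> real) set" where
  "U0_inf k = {u.
     u \<in> agreeing Omega_inf
       (Q3w k (int k) (int k) (int k - 1) \<oplus>\<^sub>F {\<lambda>p. c * (p$3 ^ k / (1 + p$3) ^ k) | c. True}) \<and>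
     (\<forall>c\<in>{0, 1}.
        (\<lambda>q. u (face_y c q)) \<in> agreeing inf_face (P2w k (int k)) \<and>
        (\<lambda>q. u (face_x c q)) \<in> agreeing inf_face (P2w k (int k)))}"

definition xy :: "real^3 \<Rightarrow> real^2" where
  "xy p = vector [p$1, p$2]"

definition partial :: "2 \<Rightarrow> (real^2 \<Rightarrow> real) \<Rightarrow> real^2 \<Rightarrow> real" where
  "partial i r q = frechet_derivative r (at q) (axis i 1)"

definition U1_extra :: "nat \<Rightarrow> (real^3 \<Rightarrow> real^3) set" where
  "U1_extra k = {\<lambda>p. (p$3 ^ (k - 1) / (1 + p$3) ^ (k + 1)) *\<^sub>R
      vector [partial 1 r (xy p) * p$3, partial 2 r (xy p) * p$3, - r (xy p)]
    | r. r \<in> Q2 (int k) (int k)}"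

definition U1_face :: "nat \<Rightarrow> (real^2 \<Rightarrow> real^2) set" where
  "U1_face k = pair_space (P2w (k + 1) (int k - 1)) (P2w (k + 1) (int k - 1)) \<oplus>\<^sub>F
     {\<lambda>q. g q *\<^sub>R vector [1 + q$2, - q$1] | g. g \<in> hom_w (k + 1) (k - 1)}"

definition U1_inf :: "nat \<Rightarrow> (real^3 \<Rightarrow> real^3) set" where
  "U1_inf k = {u.
     u \<in> agreeing Omega_inf
       (triple_space (Q3w (k + 1) (int k - 1) (int k) (int k - 1))
                     (Q3w (k + 1) (int k) (int k - 1) (int k - 1))
                     (Q3w (k + 1) (int k) (int k) (int k - 2)) \<oplus>\<^sub>F U1_extra k) \<and>
     (\<forall>c\<in>{0, 1}.
        (\<lambda>q. vector [u (face_y c q) $ 1, u (face_y c q) $ 3]) \<in> agreeing inf_face (U1_face k) \<and>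
        (\<lambda>q. vector [u (face_x c q) $ 2, u (face_x c q) $ 3]) \<in> agreeing inf_face (U1_face k))}"

definition U2_extra_s :: "nat \<Rightarrow> (real^3 \<Rightarrow> real^3) set" where
  "U2_extra_s k = {\<lambda>p. (p$3 ^ (k - 1) / (1 + p$3) ^ (k + 2)) *\<^sub>R
      vector [0, 2 * s (xy p), partial 2 s (xy p) * (1 + p$3)]
    | s. s \<in> Q2 (int k - 1) (int k)}"

definition U2_extra_t :: "nat \<Rightarrow> (real^3 \<Rightarrow> real^3) set" where
  "U2_extra_t k = {\<lambda>p. (p$3 ^ (k - 1) / (1 + p$3) ^ (k + 2)) *\<^sub>R
      vector [2 * t (xy p), 0, partial 1 t (xy p) * (1 + p$3)]
    | t. t \<in> Q2 (int k) (int k - 1)}"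

definition U2_inf :: "nat \<Rightarrow> (real^3 \<Rightarrow> real^3) set" where
  "U2_inf k = {u.
     u \<in> agreeing Omega_inf
       (triple_space (Q3w (k + 2) (int k) (int k - 1) (int k - 2))
                     (Q3w (k + 2) (int k - 1) (int k) (int k - 2))
                     (Q3w (k + 2) (int k - 1) (int k - 1) (int k - 1))
        \<oplus>\<^sub>F U2_extra_s k \<oplus>\<^sub>F U2_extra_t k) \<and>
     (\<forall>c\<in>{0, 1}.
        (\<lambda>q. u (face_y c q) $ 2) \<in> agreeing inf_face (P2w (k + 2) (int k - 1)) \<and>
        (\<lambda>q. u (face_x c q) $ 1) \<in> agreeing inf_face (P2w (k + 2) (int k - 1)))}"

text \<open>
  The image under \<open>(\<phi>\<^sup>*)\<^sup>-\<^sup>1\<close> is the preimage under \<open>\<phi>\<^sup>*\<close>, which is a bijection between forms on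
  the pyramid without its apex and forms on the infinite pyramid.
\<close>

definition U0 :: "nat \<Rightarrow> (real^3 \<Rightarrow> real) set" where
  "U0 k = {u. pullback0 u \<in> U0_inf k}"

definition U1 :: "nat \<Rightarrow> (real^3 \<Rightarrow> real^3) set" where
  "U1 k = {E. pullback1 E \<in> U1_inf k}"

definition U2 :: "nat \<Rightarrow> (real^3 \<Rightarrow> real^3) set" where
  "U2 k = {v. pullback2 v \<in> U2_inf k}"

datatype face = S1 | S2 | S3 | S4 | Base

fun face_set :: "face \<Rightarrow> (real^3) set" where
  "face_set S1 = Omega \<inter> {p. p$2 = 0}"
| "face_set S2 = Omega \<inter> {p. p$1 = 1 - p$3}"
| "face_set S3 = Omega \<inter> {p. p$2 = 1 - p$3}"
| "face_set S4 = Omega \<inter> {p. p$1 = 0}"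
| "face_set Base = Omega \<inter> {p. p$3 = 0}"

text \<open>
  The inclusion of a face, written in the face coordinates \<open>(\<xi>, \<zeta>)\<close> on \<open>S1\<close>, \<open>S3\<close>,
  \<open>(\<eta>, \<zeta>)\<close> on \<open>S2\<close>, \<open>S4\<close> and \<open>(\<xi>, \<eta>)\<close> on \<open>Base\<close>.
\<close>

fun chart :: "face \<Rightarrow> real^2 \<Rightarrow> real^3" where
  "chart S1 q = vector [q$1, 0, q$2]"
| "chart S2 q = vector [1 - q$2, q$1, q$2]"
| "chart S3 q = vector [q$1, 1 - q$2, q$2]"
| "chart S4 q = vector [0, q$1, q$2]"
| "chart Base q = vector [q$1, q$2, 0]"

text \<open>The apex is omitted because the members of the element spaces are not defined there.\<close>

definition face_dom :: "face \<Rightarrow> (real^2) set" where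
  "face_dom F = {q. chart F q \<in> face_set F - {apex}}"

text \<open>
  Pullbacks under the inclusion of a face.  A 2-form with proxy \<open>v\<close> pulls back to
  \<open>v \<bullet> (\<partial>\<^sub>1 \<times> \<partial>\<^sub>2)\<close>, with \<open>\<partial>\<^sub>1\<close>, \<open>\<partial>\<^sub>2\<close> the coordinate tangent vectors of the face.
\<close>

definition trace0 :: "face \<Rightarrow> (real^3 \<Rightarrow> real) \<Rightarrow> real^2 \<Rightarrow> real" where
  "trace0 F u = restrict (\<lambda>q. u (chart F q)) (face_dom F)"

definition trace1 :: "face \<Rightarrow> (real^3 \<Rightarrow> real^3) \<Rightarrow> real^2 \<Rightarrow> real^2" where
  "trace1 F E = restrict (\<lambda>q. transpose (jacobian (chart F) (at q)) *v E (chart F q)) (face_dom F)"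

definition trace2 :: "face \<Rightarrow> (real^3 \<Rightarrow> real^3) \<Rightarrow> real^2 \<Rightarrow> real" where
  "trace2 F v = restrict (\<lambda>q. v (chart F q) \<bullet>
     cross3 (column 1 (jacobian (chart F) (at q))) (column 2 (jacobian (chart F) (at q))))
     (face_dom F)"

definition tau0 :: "nat \<Rightarrow> (real^2 \<Rightarrow> real) set" where
  "tau0 k = P2 (int k)"

definition S_space :: "real^2 \<Rightarrow> nat \<Rightarrow> (real^2 \<Rightarrow> real^2) set" where
  "S_space q0 k = {w \<in> pair_space (hom_poly q0 k) (hom_poly q0 k). \<forall>q. (q - q0) \<bullet> w q = 0}"

definition tau1 :: "real^2 \<Rightarrow> nat \<Rightarrow> (real^2 \<Rightarrow> real^2) set" where
  "tau1 q0 k = pair_space (P2 (int k - 1)) (P2 (int k - 1)) \<oplus>\<^sub>F S_space q0 k"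

definition tau2 :: "nat \<Rightarrow> (real^2 \<Rightarrow> real) set" where
  "tau2 k = P2 (int k - 1)"

definition sigma0 :: "nat \<Rightarrow> (real^2 \<Rightarrow> real) set" where
  "sigma0 k = Q2 (int k) (int k)"

definition sigma1 :: "nat \<Rightarrow> (real^2 \<Rightarrow> real^2) set" where
  "sigma1 k = pair_space (Q2 (int k - 1) (int k)) (Q2 (int k) (int k - 1))"

definition sigma2 :: "nat \<Rightarrow> (real^2 \<Rightarrow> real) set" where
  "sigma2 k = Q2 (int k - 1) (int k - 1)"

definition on_face :: "face \<Rightarrow> (real^2 \<Rightarrow> 'a) set \<Rightarrow> (real^2 \<Rightarrow> 'a) set" where
  "on_face F A = (\<lambda>f. restrict f (face_dom F)) ` A"

end

theory Submission
  imports Defs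
begin

text \<open>
  On a vertical face, \<open>\<phi>\<close> restricts to \<open>(w, z) \<mapsto> (w/(1+z), z/(1+z))\<close>, and \<open>1 - \<zeta> = 1/(1+z)\<close> makes its
  pullback a bijection between polynomials of total degree at most \<open>n\<close> and their quotients by
  \<open>(1+z)\<^sup>n\<close>.  Since pullback commutes with traces, the face conditions of the spaces on the infinite
  pyramid say exactly that the traces lie in \<open>\<tau>\<close>.

  Conversely, data on the face \<open>y = c\<close> are multiplied by the affine function of \<open>y\<close> that is \<open>1\<close> on that
  face and \<open>0\<close> on the opposite one.  This respects the degree bounds and the conditions on the adjacent
  faces except for the terms of top degree in \<open>z\<close>, which the extra summand of each space absorbs.  The faces
  \<open>x = c\<close> follow by exchanging \<open>x\<close> and \<open>y\<close>.  Data on the base are extended constantly in \<open>z\<close> and divided by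
  the power of \<open>1 + z\<close>.
\<close>

subsection \<open>Spaces of polynomials\<close>

text \<open>The obstacle is the gap between two notions of degree: a face polynomial of total degree
  n may contain z^n, while the tensor-product parts stop one power of z earlier. For 0- and 2-forms
  a single coefficient per face is left over, that of z^k or z^(k-1). For 1-forms, up to the common
  denominator, the field (1+z, -w) of the face space produces c z^k in the first component and -c w
  z^(k-1) in the second, tied by the same c. The field z^(k-1) (r_x z, r_y z, -r) has exactly this
  tie when r is affine in x. Cutting r off in y then creates the term r_y z^k on the adjacent faces,
  whose degree is too high for the polynomial part there. It is admissible because z^k and (1+z)^k
  have the same leading term, so that a multiple of (1+z)^(k-1) (1+z, -w) takes it up. For 1-forms
  the definition of \<tau> by orthogonality to a position vector also has to be traded for a
  description by 1 - \<zeta> and \<xi>, since these are the quantities that the pullback turns into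
  the face space.\<close>

definition lincomb :: "('i \<Rightarrow> 'a \<Rightarrow> real) \<Rightarrow> 'i set \<Rightarrow> ('a \<Rightarrow> real) set" where
  "lincomb B I = {\<lambda>q. \<Sum>i\<in>I. c i * B i q | c. True}"

lemma lincombI: "(\<lambda>q. \<Sum>i\<in>I. c i * B i q) \<in> lincomb B I"
  unfolding lincomb_def by blast

lemma lincomb_zero: "(\<lambda>q. 0) \<in> lincomb B I"
  using lincombI[of "\<lambda>i. 0" B I] by simp

lemma lincomb_add:
  assumes "f \<in> lincomb B I" "g \<in> lincomb B I"
  shows "(\<lambda>q. f q + g q) \<in> lincomb B I"
proof -
  obtain c d where "f = (\<lambda>q. \<Sum>i\<in>I. c i * B i q)" "g = (\<lambda>q. \<Sum>i\<in>I. d i * B i q)"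
    using assms unfolding lincomb_def by blast
  then show ?thesis
    using lincombI[of "\<lambda>i. c i + d i" B I] by (simp add: sum.distrib algebra_simps)
qed

lemma lincomb_scale:
  assumes "f \<in> lincomb B I"
  shows "(\<lambda>q. a * f q) \<in> lincomb B I"
proof -
  obtain c where "f = (\<lambda>q. \<Sum>i\<in>I. c i * B i q)"
    using assms unfolding lincomb_def by blast
  then show ?thesis
    using lincombI[of "\<lambda>i. a * c i" B I] by (simp add: sum_distrib_left mult.assoc)
qed

lemma lincomb_base:
  assumes "finite I" "i \<in> I"
  shows "B i \<in> lincomb B I"
proof -
  have "(\<lambda>q. \<Sum>j\<in>I. (if j = i then 1 else 0) * B j q) = B i"
    using assms by (simp add: if_distrib[of "\<lambda>c. c * _"] cong: if_cong)
  then show ?thesis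
    using lincombI[of "\<lambda>j. if j = i then 1 else 0" B I] by simp
qed

text \<open>Linear conditions need to be checked on scaled monomials only; most degree bounds below
  are obtained this way. For an infinite \<open>I\<close> the sum is 0 by convention, which the case
  \<open>zero\<close> covers.\<close>

lemma lincomb_induct [consumes 1, case_names zero add base]:
  assumes "f \<in> lincomb B I"
    and "Pr (\<lambda>q. 0)"
    and "\<And>f g. Pr f \<Longrightarrow> Pr g \<Longrightarrow> Pr (\<lambda>q. f q + g q)"
    and "\<And>a i. i \<in> I \<Longrightarrow> Pr (\<lambda>q. a * B i q)"
  shows "Pr f"
proof -
  obtain c where f: "f = (\<lambda>q. \<Sum>i\<in>I. c i * B i q)"
    using assms(1) unfolding lincomb_def by blast
  have "J \<subseteq> I \<Longrightarrow> Pr (\<lambda>q. \<Sum>i\<in>J. c i * B i q)" if "finite J" for J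
    using that by (induction J rule: finite_induct) (auto intro: assms)
  then show ?thesis
    using assms(2) f by (cases "finite I") auto
qed

lemma finite_nat_le_int: "finite {i::nat. int i \<le> n}"
  by (rule finite_subset[of _ "{..nat n}"]) auto

lemma finite_total_degree: "finite {(i::nat, j::nat). int i + int j \<le> n}"
  by (rule finite_subset[of _ "{..nat n} \<times> {..nat n}"]) auto

lemma P2_lincomb:
  "P2 n = lincomb (\<lambda>(i, j) q. q$1 ^ i * q$2 ^ j) {(i, j). int i + int j \<le> n}"
proof (intro equalityI subsetI)
  fix f assume "f \<in> P2 n"
  then obtain c where "f = (\<lambda>q. \<Sum>(i, j)\<in>{(i, j). int i + int j \<le> n}. c i j * q$1 ^ i * q$2 ^ j)"
    unfolding P2_def by blast
  then show "f \<in> lincomb (\<lambda>(i, j) q. q$1 ^ i * q$2 ^ j) {(i, j). int i + int j \<le> n}"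
    using lincombI[of "\<lambda>(i, j). c i j" "\<lambda>(i, j) q. q$1 ^ i * q$2 ^ j" "{(i, j). int i + int j \<le> n}"]
    by (simp add: case_prod_unfold mult.assoc)
next
  fix f :: "real^2 \<Rightarrow> real"
  assume "f \<in> lincomb (\<lambda>(i, j) q. q$1 ^ i * q$2 ^ j) {(i, j). int i + int j \<le> n}"
  then obtain c where "f = (\<lambda>q. \<Sum>(i, j)\<in>{(i, j). int i + int j \<le> n}. c (i, j) * q$1 ^ i * q$2 ^ j)"
    unfolding lincomb_def by (auto simp: case_prod_unfold mult.assoc)
  then show "f \<in> P2 n"
    unfolding P2_def by (auto intro!: exI[of _ "\<lambda>i j. c (i, j)"])
qed

lemma Q2_lincomb:
  "Q2 m n = lincomb (\<lambda>(i, j) q. q$1 ^ i * q$2 ^ j) ({i. int i \<le> m} \<times> {j. int j \<le> n})"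
proof (intro equalityI subsetI)
  fix f assume "f \<in> Q2 m n"
  then obtain c where "f = (\<lambda>q. \<Sum>i | int i \<le> m. \<Sum>j | int j \<le> n. c i j * q$1 ^ i * q$2 ^ j)"
    unfolding Q2_def by blast
  then show "f \<in> lincomb (\<lambda>(i, j) q. q$1 ^ i * q$2 ^ j) ({i. int i \<le> m} \<times> {j. int j \<le> n})"
    using lincombI[of "\<lambda>(i, j). c i j" "\<lambda>(i, j) q. q$1 ^ i * q$2 ^ j" "{i. int i \<le> m} \<times> {j. int j \<le> n}"]
    by (simp add: case_prod_unfold mult.assoc sum.cartesian_product)
next
  fix f :: "real^2 \<Rightarrow> real"
  assume "f \<in> lincomb (\<lambda>(i, j) q. q$1 ^ i * q$2 ^ j) ({i. int i \<le> m} \<times> {j. int j \<le> n})"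
  then obtain c where "f = (\<lambda>q. \<Sum>i | int i \<le> m. \<Sum>j | int j \<le> n. c (i, j) * q$1 ^ i * q$2 ^ j)"
    unfolding lincomb_def by (auto simp: case_prod_unfold mult.assoc sum.cartesian_product)
  then show "f \<in> Q2 m n"
    unfolding Q2_def by (auto intro!: exI[of _ "\<lambda>i j. c (i, j)"])
qed

lemma Q3_lincomb:
  "Q3 l m n = lincomb (\<lambda>(h, i, j) p. p$1 ^ h * p$2 ^ i * p$3 ^ j)
     ({h. int h \<le> l} \<times> {i. int i \<le> m} \<times> {j. int j \<le> n})"
proof (intro equalityI subsetI)
  fix f assume "f \<in> Q3 l m n"
  then obtain c where "f = (\<lambda>p. \<Sum>h | int h \<le> l. \<Sum>i | int i \<le> m. \<Sum>j | int j \<le> n.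
      c h i j * p$1 ^ h * p$2 ^ i * p$3 ^ j)"
    unfolding Q3_def by blast
  then show "f \<in> lincomb (\<lambda>(h, i, j) p. p$1 ^ h * p$2 ^ i * p$3 ^ j)
     ({h. int h \<le> l} \<times> {i. int i \<le> m} \<times> {j. int j \<le> n})"
    using lincombI[of "\<lambda>(h, i, j). c h i j" "\<lambda>(h, i, j) p. p$1 ^ h * p$2 ^ i * p$3 ^ j"
        "{h. int h \<le> l} \<times> {i. int i \<le> m} \<times> {j. int j \<le> n}"]
    by (simp add: case_prod_unfold mult.assoc sum.cartesian_product)
next
  fix f :: "real^3 \<Rightarrow> real"
  assume "f \<in> lincomb (\<lambda>(h, i, j) p. p$1 ^ h * p$2 ^ i * p$3 ^ j)
     ({h. int h \<le> l} \<times> {i. int i \<le> m} \<times> {j. int j \<le> n})"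
  then obtain c where "f = (\<lambda>p. \<Sum>h | int h \<le> l. \<Sum>i | int i \<le> m. \<Sum>j | int j \<le> n.
      c (h, i, j) * p$1 ^ h * p$2 ^ i * p$3 ^ j)"
    unfolding lincomb_def by (auto simp: case_prod_unfold mult.assoc sum.cartesian_product)
  then show "f \<in> Q3 l m n"
    unfolding Q3_def by (auto intro!: exI[of _ "\<lambda>h i j. c (h, i, j)"])
qed

lemma hom_poly_lincomb:
  "hom_poly q0 n = lincomb (\<lambda>i q. (q$1 - q0$1) ^ i * (q$2 - q0$2) ^ (n - i)) {..n}"
  unfolding hom_poly_def lincomb_def by (simp add: mult.assoc)

lemmas poly_lincomb = P2_lincomb Q2_lincomb Q3_lincomb hom_poly_lincomb

lemma poly_zero [simp]:
  "(\<lambda>q. 0) \<in> P2 n" "(\<lambda>q. 0) \<in> Q2 l m" "(\<lambda>q. 0) \<in> Q3 l m n" "(\<lambda>q. 0) \<in> hom_poly q0 d"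
  unfolding poly_lincomb by (rule lincomb_zero)+

lemma poly_add:
  "f \<in> P2 n \<Longrightarrow> g \<in> P2 n \<Longrightarrow> (\<lambda>q. f q + g q) \<in> P2 n"
  "f \<in> Q2 l m \<Longrightarrow> g \<in> Q2 l m \<Longrightarrow> (\<lambda>q. f q + g q) \<in> Q2 l m"
  "f' \<in> Q3 l m n \<Longrightarrow> g' \<in> Q3 l m n \<Longrightarrow> (\<lambda>q. f' q + g' q) \<in> Q3 l m n"
  "f \<in> hom_poly q0 d \<Longrightarrow> g \<in> hom_poly q0 d \<Longrightarrow> (\<lambda>q. f q + g q) \<in> hom_poly q0 d"
  unfolding poly_lincomb by (rule lincomb_add; assumption)+

lemma poly_scale:
  "f \<in> P2 n \<Longrightarrow> (\<lambda>q. a * f q) \<in> P2 n"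
  "f \<in> Q2 l m \<Longrightarrow> (\<lambda>q. a * f q) \<in> Q2 l m"
  "f' \<in> Q3 l m n \<Longrightarrow> (\<lambda>q. a * f' q) \<in> Q3 l m n"
  "f \<in> hom_poly q0 d \<Longrightarrow> (\<lambda>q. a * f q) \<in> hom_poly q0 d"
  unfolding poly_lincomb by (rule lincomb_scale; assumption)+

lemma poly_minus:
  "f \<in> P2 n \<Longrightarrow> (\<lambda>q. - f q) \<in> P2 n"
  "f \<in> Q2 l m \<Longrightarrow> (\<lambda>q. - f q) \<in> Q2 l m"
  using poly_scale(1)[of f n "-1"] poly_scale(2)[of f l m "-1"]
  by simp_all

lemma poly_diff:
  "f \<in> P2 n \<Longrightarrow> g \<in> P2 n \<Longrightarrow> (\<lambda>q. f q - g q) \<in> P2 n"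
  "f \<in> Q2 l m \<Longrightarrow> g \<in> Q2 l m \<Longrightarrow> (\<lambda>q. f q - g q) \<in> Q2 l m"
  using poly_add(1)[OF _ poly_minus(1), of f n g] poly_add(2)[OF _ poly_minus(2), of f l m g]
  by simp_all

lemma P2_monom: "int i + int j \<le> n \<Longrightarrow> (\<lambda>q. q$1 ^ i * q$2 ^ j) \<in> P2 n"
  using lincomb_base[OF finite_total_degree[of n], of "(i, j)" "\<lambda>(i, j) q. q$1 ^ i * q$2 ^ j"]
  by (simp add: P2_lincomb)

lemma Q2_monom: "int i \<le> m \<Longrightarrow> int j \<le> n \<Longrightarrow> (\<lambda>q. q$1 ^ i * q$2 ^ j) \<in> Q2 m n"
  using lincomb_base[of "{i. int i \<le> m} \<times> {j. int j \<le> n}" "(i, j)" "\<lambda>(i, j) q. q$1 ^ i * q$2 ^ j"]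
  by (simp add: Q2_lincomb finite_nat_le_int)

lemma Q3_monom:
  "int h \<le> l \<Longrightarrow> int i \<le> m \<Longrightarrow> int j \<le> n \<Longrightarrow> (\<lambda>p. p$1 ^ h * p$2 ^ i * p$3 ^ j) \<in> Q3 l m n"
  using lincomb_base[of "{h. int h \<le> l} \<times> {i. int i \<le> m} \<times> {j. int j \<le> n}" "(h, i, j)"
      "\<lambda>(h, i, j) p. p$1 ^ h * p$2 ^ i * p$3 ^ j"]
  by (simp add: Q3_lincomb finite_nat_le_int)

lemma hom_poly_monom:
  "i \<le> n \<Longrightarrow> (\<lambda>q. (q$1 - q0$1) ^ i * (q$2 - q0$2) ^ (n - i)) \<in> hom_poly q0 n"
  using lincomb_base[of "{..n}" i] by (simp add: hom_poly_lincomb)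

lemma P2_induct [consumes 1, case_names zero add monom]:
  assumes "f \<in> P2 n" "Pr (\<lambda>q. 0)"
    and "\<And>f g. Pr f \<Longrightarrow> Pr g \<Longrightarrow> Pr (\<lambda>q. f q + g q)"
    and "\<And>a i j. int i + int j \<le> n \<Longrightarrow> Pr (\<lambda>q. a * (q$1 ^ i * q$2 ^ j))"
  shows "Pr f"
  using assms(1) unfolding P2_lincomb
  by (induction rule: lincomb_induct) (auto intro: assms)

lemma Q2_induct [consumes 1, case_names zero add monom]:
  assumes "f \<in> Q2 m n" "Pr (\<lambda>q. 0)"
    and "\<And>f g. Pr f \<Longrightarrow> Pr g \<Longrightarrow> Pr (\<lambda>q. f q + g q)"
    and "\<And>a i j. int i \<le> m \<Longrightarrow> int j \<le> n \<Longrightarrow> Pr (\<lambda>q. a * (q$1 ^ i * q$2 ^ j))"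
  shows "Pr f"
  using assms(1) unfolding Q2_lincomb
  by (induction rule: lincomb_induct) (auto intro: assms)

lemma Q3_induct [consumes 1, case_names zero add monom]:
  assumes "f \<in> Q3 l m n" "Pr (\<lambda>p. 0)"
    and "\<And>f g. Pr f \<Longrightarrow> Pr g \<Longrightarrow> Pr (\<lambda>p. f p + g p)"
    and "\<And>a h i j. int h \<le> l \<Longrightarrow> int i \<le> m \<Longrightarrow> int j \<le> n \<Longrightarrow>
      Pr (\<lambda>p. a * (p$1 ^ h * p$2 ^ i * p$3 ^ j))"
  shows "Pr f"
  using assms(1) unfolding Q3_lincomb
  by (induction rule: lincomb_induct) (auto intro: assms)

lemma hom_poly_induct [consumes 1, case_names zero add monom]:
  assumes "f \<in> hom_poly q0 n" "Pr (\<lambda>q. 0)"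
    and "\<And>f g. Pr f \<Longrightarrow> Pr g \<Longrightarrow> Pr (\<lambda>q. f q + g q)"
    and "\<And>a i. i \<le> n \<Longrightarrow> Pr (\<lambda>q. a * ((q$1 - q0$1) ^ i * (q$2 - q0$2) ^ (n - i)))"
  shows "Pr f"
  using assms(1) unfolding hom_poly_lincomb
  by (induction rule: lincomb_induct) (auto intro: assms)

lemma P2_mono: "f \<in> P2 m \<Longrightarrow> m \<le> n \<Longrightarrow> f \<in> P2 n"
  by (induction rule: P2_induct) (auto intro!: poly_add poly_scale P2_monom)

lemma P2_mult_monom:
  "f \<in> P2 m \<Longrightarrow> m + int i + int j \<le> n \<Longrightarrow> (\<lambda>q. q$1 ^ i * q$2 ^ j * f q) \<in> P2 n"
proof (induction rule: P2_induct)
  case (add f g)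
  then show ?case by (simp add: distrib_left poly_add)
next
  case (monom a i' j')
  have "(\<lambda>q::real^2. a * (q$1 ^ (i + i') * q$2 ^ (j + j'))) \<in> P2 n"
    using monom by (intro poly_scale P2_monom) auto
  then show ?case by (simp add: power_add mult_ac)
qed simp

lemma P2_mult:
  assumes "f \<in> P2 m" "g \<in> P2 n" "m + n \<le> d"
  shows "(\<lambda>q. f q * g q) \<in> P2 d"
  using assms(1)
proof (induction rule: P2_induct)
  case (add f h)
  then show ?case by (simp add: distrib_right poly_add)
next
  case (monom a i j)
  then have "(\<lambda>q. a * (q$1 ^ i * q$2 ^ j * g q)) \<in> P2 d"
    using assms by (intro poly_scale P2_mult_monom) auto
  then show ?case by (simp add: mult_ac)
qed simp

lemma P2_const: "0 \<le> n \<Longrightarrow> (\<lambda>q. a) \<in> P2 n"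
  using poly_scale(1)[OF P2_monom[of 0 0 n], of a] by simp

lemma P2_coord1: "1 \<le> n \<Longrightarrow> (\<lambda>q. q$1) \<in> P2 n"
  using P2_monom[of 1 0 n] by simp

lemma P2_coord2: "1 \<le> n \<Longrightarrow> (\<lambda>q. q$2) \<in> P2 n"
  using P2_monom[of 0 1 n] by simp

lemma P2_power:
  assumes "f \<in> P2 1" "int j \<le> n"
  shows "(\<lambda>q. f q ^ j) \<in> P2 n"
  using assms(2)
proof (induction j arbitrary: n)
  case 0
  then show ?case by (simp add: P2_const)
next
  case (Suc j)
  have "(\<lambda>q. f q * f q ^ j) \<in> P2 n"
    by (rule P2_mult[OF assms(1) Suc.IH[of "n - 1"]]) (use Suc.prems in auto)
  then show ?case by simp
qed

lemma sum_spaceI: "f \<in> A \<Longrightarrow> g \<in> B \<Longrightarrow> (\<lambda>p. f p + g p) \<in> A \<oplus>\<^sub>F B"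
  unfolding sum_space_def by blast

lemma pair_spaceI: "f \<in> A \<Longrightarrow> g \<in> B \<Longrightarrow> (\<lambda>p. vector [f p, g p]) \<in> pair_space A B"
  unfolding pair_space_def by blast

lemma triple_spaceI:
  "f \<in> A \<Longrightarrow> g \<in> B \<Longrightarrow> h \<in> C \<Longrightarrow> (\<lambda>p. vector [f p, g p, h p]) \<in> triple_space A B C"
  unfolding triple_space_def by blast

section \<open>Leading forms and division by 1 - \<zeta> for polynomials in two variables\<close>

lemma poly_sub_shift:
  fixes a :: real
  assumes i: "int i - 1 \<le> n"
  shows "(\<lambda>q. q$1 ^ i - (q$1 - a) ^ i) \<in> P2 n" "(\<lambda>q. q$2 ^ i - (q$2 - a) ^ i) \<in> P2 n"
proof -
  have *: "(\<lambda>q. f q ^ i - (f q - a) ^ i) \<in> P2 n" if f: "f \<in> P2 1" for f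
    using i
  proof (induction i arbitrary: n)
    case (Suc i)
    have f': "(\<lambda>q. f q - a) \<in> P2 1"
      by (intro poly_diff f P2_const) simp
    \<comment> \<open>The next difference X^(i+1) - (X-a)^(i+1) equals X (X^i - (X-a)^i) + a
      (X-a)^i, so the cancellation of the leading terms is inherited.\<close>
    have "(\<lambda>q. f q * (f q ^ i - (f q - a) ^ i) + a * (f q - a) ^ i) \<in> P2 n"
      by (intro poly_add poly_scale P2_power f' P2_mult[OF f Suc.IH[of "n - 1"]])
        (use Suc.prems in auto)
    then show ?case by (simp add: algebra_simps)
  qed simp
  show "(\<lambda>q. q$1 ^ i - (q$1 - a) ^ i) \<in> P2 n" "(\<lambda>q. q$2 ^ i - (q$2 - a) ^ i) \<in> P2 n"
    by (auto intro: * P2_coord1 P2_coord2)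
qed

lemma P2_shift_coord: "(\<lambda>q. q$1 - a) \<in> P2 1" "(\<lambda>q. q$2 - a) \<in> P2 1"
  by (intro poly_diff P2_const P2_coord1 P2_coord2; simp)+

lemma hom_poly_subset_P2: "g \<in> hom_poly q0 n \<Longrightarrow> g \<in> P2 (int n)"
proof (induction rule: hom_poly_induct)
  case (monom a i)
  show ?case
    by (intro poly_scale P2_mult[OF P2_power[OF P2_shift_coord(1) order.refl]
          P2_power[OF P2_shift_coord(2) order.refl]]) (use monom in auto)
qed (auto intro: poly_add)

text \<open>Moving the origin to \<open>q0\<close> in the leading form changes terms of lower degree
  only. This is the reason why the centre does not matter for \<open>tau1\<close>.\<close>

lemma P2_hom_decomp:
  assumes "f \<in> P2 (int n)"
  obtains g l where "g \<in> hom_poly q0 n" "l \<in> P2 (int n - 1)" "\<And>q. f q = g q + l q"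
proof -
  have "\<exists>g l. g \<in> hom_poly q0 n \<and> l \<in> P2 (int n - 1) \<and> (\<forall>q. f q = g q + l q)"
    using assms
  proof (induction rule: P2_induct)
    case zero
    show ?case
      by (intro exI[of _ "\<lambda>q. 0"]) simp
  next
    case (add f g)
    then obtain f1 f2 g1 g2 where
      "f1 \<in> hom_poly q0 n" "f2 \<in> P2 (int n - 1)" "\<And>q. f q = f1 q + f2 q"
      "g1 \<in> hom_poly q0 n" "g2 \<in> P2 (int n - 1)" "\<And>q. g q = g1 q + g2 q"
      by blast
    then show ?case
      by (intro exI[of _ "\<lambda>q. f1 q + g1 q"] exI[of _ "\<lambda>q. f2 q + g2 q"]) (auto intro: poly_add)
  next
    case (monom a i j)
    show ?case
    proof (cases "i + j = n")
      case True
      define g :: "real^2 \<Rightarrow> real" where "g q = a * ((q$1 - q0$1) ^ i * (q$2 - q0$2) ^ (n - i))" for q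
      \<comment> \<open>The difference of the two products, telescoped by shifting one factor at a
        time; each shift loses a degree.\<close>
      define l :: "real^2 \<Rightarrow> real" where "l q = a * ((q$1 ^ i - (q$1 - q0$1) ^ i) * (q$2 - q0$2) ^ j +
          q$1 ^ i * (q$2 ^ j - (q$2 - q0$2) ^ j))" for q
      have "g \<in> hom_poly q0 n"
        unfolding g_def using True by (intro poly_scale hom_poly_monom) auto
      moreover have "l \<in> P2 (int n - 1)"
        unfolding l_def
        by (intro poly_scale poly_add
            P2_mult[OF poly_sub_shift(1)[OF order.refl] P2_power[OF P2_shift_coord(2) order.refl]]
            P2_mult[OF P2_power[OF P2_coord1[OF order.refl] order.refl] poly_sub_shift(2)[OF order.refl]])
          (use True in auto)
      moreover have "a * (q$1 ^ i * q$2 ^ j) = g q + l q" for q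
        using True by (auto simp: g_def l_def algebra_simps)
      ultimately show ?thesis by blast
    next
      case False
      then have "(\<lambda>q. a * (q$1 ^ i * q$2 ^ j)) \<in> P2 (int n - 1)"
        using monom by (intro poly_scale P2_monom) auto
      then show ?thesis
        by (intro exI[of _ "\<lambda>q. 0"] exI[of _ "\<lambda>q. a * (q$1 ^ i * q$2 ^ j)"]) auto
    qed
  qed
  then show ?thesis using that by blast
qed

text \<open>Iterating \<xi>^i \<zeta>^(j+1) = \<xi>^i \<zeta>^j - (1 - \<zeta>) \<xi>^i \<zeta>^j
  removes \<zeta> from the remainder. On the infinite face that remainder becomes the summand
  \<open>hom_w\<close> of \<open>U1_face\<close>.\<close>

lemma P2_div_one_minus:
  assumes "f \<in> P2 (int n)"
  obtains l c where "l \<in> P2 (int n - 1)" "\<And>q. f q = (1 - q$2) * l q + (\<Sum>a\<le>n. c a * q$1 ^ a)"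
proof -
  have mono: "\<exists>l c. l \<in> P2 (int n - 1) \<and>
      (\<forall>q. q$1 ^ i * q$2 ^ j = (1 - q$2) * l q + (\<Sum>a\<le>n. c a * q$1 ^ a))"
    if "i + j \<le> n" for i j
    using that
  proof (induction j)
    case 0
    have "q$1 ^ i = (\<Sum>a\<le>n. (if a = i then 1 else 0) * q$1 ^ a)" for q :: "real^2"
      using 0 by (simp add: if_distrib[of "\<lambda>c. c * _"] cong: if_cong)
    then show ?case
      by (intro exI[of _ "\<lambda>q. 0"] exI[of _ "\<lambda>a. if a = i then 1 else 0"]) simp
  next
    case (Suc j)
    then obtain l c where lc: "l \<in> P2 (int n - 1)"
      "\<And>q. q$1 ^ i * q$2 ^ j = (1 - q$2) * l q + (\<Sum>a\<le>n. c a * q$1 ^ a)"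
      by auto
    have "(\<lambda>q. l q - q$1 ^ i * q$2 ^ j) \<in> P2 (int n - 1)"
      using Suc.prems by (intro poly_diff lc P2_monom) auto
    moreover have "q$1 ^ i * q$2 ^ Suc j =
        (1 - q$2) * (l q - q$1 ^ i * q$2 ^ j) + (\<Sum>a\<le>n. c a * q$1 ^ a)" for q
      using lc(2)[of q] by (simp add: algebra_simps)
    ultimately show ?case by blast
  qed
  have "\<exists>l c. l \<in> P2 (int n - 1) \<and> (\<forall>q. f q = (1 - q$2) * l q + (\<Sum>a\<le>n. c a * q$1 ^ a))"
    using assms
  proof (induction rule: P2_induct)
    case zero
    show ?case
      by (intro exI[of _ "\<lambda>q. 0"]) simp
  next
    case (add f g)
    then obtain l c m d where lm: "l \<in> P2 (int n - 1)" "m \<in> P2 (int n - 1)"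
      and fg: "\<And>q. f q = (1 - q$2) * l q + (\<Sum>a\<le>n. c a * q$1 ^ a)"
      "\<And>q. g q = (1 - q$2) * m q + (\<Sum>a\<le>n. d a * q$1 ^ a)"
      by blast
    then show ?case
      by (intro exI[of _ "\<lambda>q. l q + m q"] exI[of _ "\<lambda>a. c a + d a"])
        (auto intro: poly_add lm simp: fg algebra_simps sum.distrib)
  next
    case (monom b i j)
    then obtain l c where lc: "l \<in> P2 (int n - 1)"
      "\<And>q. q$1 ^ i * q$2 ^ j = (1 - q$2) * l q + (\<Sum>a\<le>n. c a * q$1 ^ a)"
      using mono[of i j] by auto
    show ?case
      by (intro exI[of _ "\<lambda>q. b * l q"] exI[of _ "\<lambda>a. b * c a"])
        (auto intro: poly_scale lc simp: lc(2) algebra_simps sum_distrib_left)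
  qed
  then show ?thesis using that by blast
qed

section \<open>Homogeneous fields orthogonal to the position vector\<close>

lemma vec2_eq_iff: "(v::real^2) = w \<longleftrightarrow> v$1 = w$1 \<and> v$2 = w$2"
  by (simp add: vec_eq_iff forall_2)

lemma vec3_eq_iff: "(v::real^3) = w \<longleftrightarrow> v$1 = w$1 \<and> v$2 = w$2 \<and> v$3 = w$3"
  by (simp add: vec_eq_iff forall_3)

text \<open>The two sums are the components of a homogeneous field on the line where the second
  shifted coordinate is 1, and the assumption is orthogonality to the position (x, 1). Comparing
  coefficients of equal powers of x gives the relations.\<close>

lemma hom_poly_orthogonal:
  fixes c d :: "nat \<Rightarrow> real"
  assumes "\<And>x. x * (\<Sum>i\<le>Suc n. c i * x ^ i) + (\<Sum>i\<le>Suc n. d i * x ^ i) = 0"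
  shows "d 0 = 0 \<and> c (Suc n) = 0 \<and> (\<forall>i\<le>n. d (Suc i) = - c i)"
proof -
  \<comment> \<open>The coefficient of x^i in the whole expression. The factor x shifts
    \<open>c\<close> up by one, so the index runs to \<open>Suc (Suc n)\<close>, where
    \<open>d\<close> has no term left.\<close>
  define e where "e i = (if i = 0 then 0 else c (i - 1)) + (if i \<le> Suc n then d i else 0)" for i
  have "(\<Sum>i\<le>Suc (Suc n). e i * x ^ i) = 0" for x :: real
  proof -
    have "(\<Sum>i\<le>Suc (Suc n). (if i = 0 then 0 else c (i - 1)) * x ^ i) = x * (\<Sum>i\<le>Suc n. c i * x ^ i)"
      by (subst sum.atMost_Suc_shift) (simp add: sum_distrib_left mult_ac del: sum.atMost_Suc)
    moreover have "(\<Sum>i\<le>Suc (Suc n). (if i \<le> Suc n then d i else 0) * x ^ i) = (\<Sum>i\<le>Suc n. d i * x ^ i)"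
      by (subst sum.atMost_Suc) simp
    ultimately show ?thesis
      using assms[of x] by (simp add: e_def distrib_right sum.distrib del: sum.atMost_Suc)
  qed
  then have "\<And>i. i \<le> Suc (Suc n) \<Longrightarrow> e i = 0"
    using polyfun_eq_0[of e "Suc (Suc n)"] by blast
  then have "e 0 = 0" "e (Suc (Suc n)) = 0" "\<And>i. i \<le> n \<Longrightarrow> e (Suc i) = 0"
    by simp_all
  then show ?thesis
    by (simp add: e_def add_eq_0_iff)
qed

text \<open>In the plane the vectors orthogonal to q - q0 are the multiples of its rotation by a
  right angle; the point is that the factor is again a form. The vanishing of
  \<open>c (Suc n)\<close> and \<open>d 0\<close> makes each component divisible by the matching
  coordinate of q - q0, and the remaining relations say that both quotients agree.\<close>

lemma S_space_eq:
  "S_space q0 (Suc n) =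
    {\<lambda>q. g q *\<^sub>R vector [- (q$2 - q0$2), q$1 - q0$1] | g. g \<in> hom_poly q0 n}"
proof (intro equalityI subsetI)
  fix w :: "real^2 \<Rightarrow> real^2" assume "w \<in> S_space q0 (Suc n)"
  then obtain c d where
    w: "w = (\<lambda>q. vector [\<Sum>i\<le>Suc n. c i * (q$1 - q0$1) ^ i * (q$2 - q0$2) ^ (Suc n - i),
                        \<Sum>i\<le>Suc n. d i * (q$1 - q0$1) ^ i * (q$2 - q0$2) ^ (Suc n - i)])"
    and orth: "\<And>q. (q - q0) \<bullet> w q = 0"
    unfolding S_space_def pair_space_def hom_poly_def by blast
  \<comment> \<open>Points q0 + (x, 1) suffice, because a form in two variables is determined by its
    values on this line.\<close>
  have "x * (\<Sum>i\<le>Suc n. c i * x ^ i) + (\<Sum>i\<le>Suc n. d i * x ^ i) = 0" for x :: real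
    using orth[of "vector [q0$1 + x, q0$2 + 1]"]
    by (simp add: w inner_vec_def sum_2 del: sum.atMost_Suc)
  then have cd: "d 0 = 0" "c (Suc n) = 0" "\<And>i. i \<le> n \<Longrightarrow> d (Suc i) = - c i"
    using hom_poly_orthogonal[where n = n and c = c and d = d] by blast+
  define g :: "real^2 \<Rightarrow> real" where "g q = (\<Sum>i\<le>n. - c i * (q$1 - q0$1) ^ i * (q$2 - q0$2) ^ (n - i))" for q
  have "w q = g q *\<^sub>R vector [- (q$2 - q0$2), q$1 - q0$1]" for q
  proof -
    have "(\<Sum>i\<le>Suc n. c i * (q$1 - q0$1) ^ i * (q$2 - q0$2) ^ (Suc n - i)) = - (q$2 - q0$2) * g q"
      unfolding g_def sum_distrib_left using cd(2)
      by (auto intro!: sum.cong simp: Suc_diff_le algebra_simps)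
    moreover have "(\<Sum>i\<le>Suc n. d i * (q$1 - q0$1) ^ i * (q$2 - q0$2) ^ (Suc n - i)) = (q$1 - q0$1) * g q"
      unfolding g_def sum_distrib_left using cd(1,3)
      by (subst sum.atMost_Suc_shift) (auto intro!: sum.cong)
    ultimately show ?thesis
      by (simp add: w vec2_eq_iff mult.commute del: sum.atMost_Suc)
  qed
  moreover have "g \<in> hom_poly q0 n"
    unfolding g_def hom_poly_def by (intro CollectI exI[of _ "\<lambda>i. - c i"]) simp
  ultimately show "w \<in> {\<lambda>q. g q *\<^sub>R vector [- (q$2 - q0$2), q$1 - q0$1] | g. g \<in> hom_poly q0 n}"
    by blast
next
  fix w :: "real^2 \<Rightarrow> real^2" assume "w \<in> {\<lambda>q. g q *\<^sub>R vector [- (q$2 - q0$2), q$1 - q0$1] | g. g \<in> hom_poly q0 n}"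
  then obtain g where g: "g \<in> hom_poly q0 n"
    and w: "w = (\<lambda>q. g q *\<^sub>R vector [- (q$2 - q0$2), q$1 - q0$1])"
    by blast
  have 1: "(\<lambda>q. (q$1 - q0$1) * g q) \<in> hom_poly q0 (Suc n)"
    using g
  proof (induction rule: hom_poly_induct)
    case (monom a i)
    then show ?case
      using poly_scale(4)[OF hom_poly_monom[of "Suc i" "Suc n" q0], of a] by (simp add: mult_ac)
  qed (auto simp: distrib_left poly_add)
  have 2: "(\<lambda>q. - (q$2 - q0$2) * g q) \<in> hom_poly q0 (Suc n)"
    using g
  proof (induction rule: hom_poly_induct)
    case (add f h)
    then show ?case
      using poly_add(4)[OF add] by (simp add: algebra_simps)
  next
    case (monom a i)
    then have "(\<lambda>q::real^2. - (q$2 - q0$2) * (a * ((q$1 - q0$1) ^ i * (q$2 - q0$2) ^ (n - i)))) =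
        (\<lambda>q. - a * ((q$1 - q0$1) ^ i * (q$2 - q0$2) ^ (Suc n - i)))"
      by (simp add: fun_eq_iff Suc_diff_le algebra_simps)
    with poly_scale(4)[OF hom_poly_monom[of i "Suc n" q0], of "- a"] monom show ?case
      by (simp only:)
  qed simp
  show "w \<in> S_space q0 (Suc n)"
    unfolding S_space_def pair_space_def w mem_Collect_eq
    by (intro conjI exI[of _ "\<lambda>q. - (q$2 - q0$2) * g q"] exI[of _ "\<lambda>q. (q$1 - q0$1) * g q"] 1 2)
      (auto simp: fun_eq_iff vec2_eq_iff inner_vec_def sum_2 algebra_simps)
qed

text \<open>
  The polynomials \<open>f\<close>, \<open>g\<close> and \<open>\<Sum>a\<le>n. c a * \<xi> ^ a\<close> are the three pieces of an element of
  \<open>U1_face\<close>, transported to the finite face.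
\<close>

lemma tau1_eq:
  "tau1 q0 (Suc n) =
    {\<lambda>q. vector [(1 - q$2) * f q + (\<Sum>a\<le>n. c a * q$1 ^ a), g q + q$1 * f q] | f g c.
      f \<in> P2 (int n) \<and> g \<in> P2 (int n)}" (is "_ = ?R")
proof (intro equalityI subsetI)
  fix e assume "e \<in> tau1 q0 (Suc n)"
  then obtain a b g where ab: "a \<in> P2 (int n)" "b \<in> P2 (int n)" and g: "g \<in> hom_poly q0 n"
    and e: "e = (\<lambda>q. vector [a q, b q] + g q *\<^sub>R vector [- (q$2 - q0$2), q$1 - q0$1])"
    unfolding tau1_def S_space_eq sum_space_def pair_space_def by auto
  have gP: "g \<in> P2 (int n)"
    using g by (rule hom_poly_subset_P2)
  \<comment> \<open>Here -(\<zeta> - \<zeta>0) g = (1 - \<zeta>) g - (1 - \<zeta>0) g. The first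
    part already has the wanted shape; the second joins \<open>a\<close> before the division by 1 -
    \<zeta>.\<close>
  have "(\<lambda>q. a q - (1 - q0$2) * g q) \<in> P2 (int n)"
    by (intro poly_diff poly_scale ab gP)
  then obtain l c where l: "l \<in> P2 (int n - 1)"
    and lc: "\<And>q. a q - (1 - q0$2) * g q = (1 - q$2) * l q + (\<Sum>a\<le>n. c a * q$1 ^ a)"
    by (rule P2_div_one_minus) auto
  have "(\<lambda>q. g q + l q) \<in> P2 (int n)"
    by (intro poly_add gP P2_mono[OF l]) simp
  moreover have "(\<lambda>q. b q - q0$1 * g q - q$1 * l q) \<in> P2 (int n)"
    by (intro poly_diff poly_scale ab gP P2_mult[OF P2_coord1[OF order.refl] l]) simp
  moreover have "e = (\<lambda>q. vector [(1 - q$2) * (g q + l q) + (\<Sum>a\<le>n. c a * q$1 ^ a),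
      (b q - q0$1 * g q - q$1 * l q) + q$1 * (g q + l q)])"
    using lc by (simp add: e fun_eq_iff vec2_eq_iff algebra_simps)
  ultimately show "e \<in> ?R"
    unfolding mem_Collect_eq
    by (intro exI[of _ "\<lambda>q. g q + l q"] exI[of _ "\<lambda>q. b q - q0$1 * g q - q$1 * l q"] exI[of _ c] conjI)
next
  fix e assume "e \<in> ?R"
  then obtain f h c where f: "f \<in> P2 (int n)" and h: "h \<in> P2 (int n)"
    and e: "e = (\<lambda>q. vector [(1 - q$2) * f q + (\<Sum>a\<le>n. c a * q$1 ^ a), h q + q$1 * f q])"
    by blast
  \<comment> \<open>Only the leading form of \<open>f\<close> is carried by the rotated field. The
    rest \<open>l\<close> has degree n - 1, so \<zeta> l and \<xi> l still fit into the polynomial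
    part.\<close>
  obtain g l where g: "g \<in> hom_poly q0 n" and l: "l \<in> P2 (int n - 1)"
    and f_eq: "\<And>q. f q = g q + l q"
    using P2_hom_decomp[OF f, of q0] by blast
  have gP: "g \<in> P2 (int n)"
    using g by (rule hom_poly_subset_P2)
  have univ: "(\<lambda>q. \<Sum>a\<le>n. c a * q$1 ^ a) \<in> P2 (int n)"
  proof -
    have "m \<le> n \<Longrightarrow> (\<lambda>q. \<Sum>a\<le>m. c a * q$1 ^ a) \<in> P2 (int n)" for m
    proof (induction m)
      case (Suc m)
      then have "(\<lambda>q. (\<Sum>a\<le>m. c a * q$1 ^ a) + c (Suc m) * (q$1 ^ Suc m * q$2 ^ 0)) \<in> P2 (int n)"
        by (intro poly_add poly_scale P2_monom) auto
      then show ?case by simp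
    qed (simp add: P2_const)
    then show ?thesis by blast
  qed
  have a: "(\<lambda>q. (1 - q0$2) * g q + (l q - q$2 * l q) + (\<Sum>a\<le>n. c a * q$1 ^ a)) \<in> P2 (int n)"
    by (intro poly_add poly_diff poly_scale gP univ P2_mono[OF l]
        P2_mult[OF P2_coord2[OF order.refl] l]) auto
  have b: "(\<lambda>q. h q + q0$1 * g q + q$1 * l q) \<in> P2 (int n)"
    by (intro poly_add poly_scale h gP P2_mult[OF P2_coord1[OF order.refl] l]) simp
  have "e = (\<lambda>q. vector [(1 - q0$2) * g q + (l q - q$2 * l q) + (\<Sum>a\<le>n. c a * q$1 ^ a),
      h q + q0$1 * g q + q$1 * l q] + g q *\<^sub>R vector [- (q$2 - q0$2), q$1 - q0$1])"
    by (simp add: e f_eq fun_eq_iff vec2_eq_iff algebra_simps)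
  with a b g show "e \<in> tau1 q0 (Suc n)"
    unfolding tau1_def S_space_eq sum_space_def pair_space_def mem_Collect_eq by fastforce
qed

subsection \<open>The projective map on a face\<close>

definition phi2 :: "real^2 \<Rightarrow> real^2" where
  "phi2 q = vector [q$1 / (1 + q$2), q$2 / (1 + q$2)]"

text \<open>In their face coordinates all four triangular faces have this same domain; the strict
  bound \<open>q$2 < 1\<close> removes the apex.\<close>

definition fin_face :: "(real^2) set" where
  "fin_face = {q. 0 \<le> q$1 \<and> 0 \<le> q$2 \<and> q$2 < 1 \<and> q$1 \<le> 1 - q$2}"

lemma phi2_in_fin_face:
  assumes "q \<in> inf_face"
  shows "phi2 q \<in> fin_face"
proof -
  have q: "0 \<le> q$1" "q$1 \<le> 1" "0 \<le> q$2"
    using assms by (auto simp: inf_face_def)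
  have "1 - phi2 q$2 = 1 / (1 + q$2)"
    using q by (simp add: phi2_def field_simps)
  moreover have "q$1 / (1 + q$2) \<le> 1 / (1 + q$2)"
    using q by (intro divide_right_mono) auto
  ultimately show ?thesis
    using q by (simp add: fin_face_def) (simp add: phi2_def)
qed

lemma phi2_image: "phi2 ` inf_face = fin_face"
proof (intro equalityI subsetI)
  fix q assume "q \<in> fin_face"
  then have q: "0 \<le> q$1" "0 \<le> q$2" "q$2 < 1" "q$1 \<le> 1 - q$2"
    by (auto simp: fin_face_def)
  define p :: "real^2" where "p = vector [q$1 / (1 - q$2), q$2 / (1 - q$2)]"
  have "p \<in> inf_face" "phi2 p = q"
    using q by (auto simp: p_def inf_face_def phi2_def vec2_eq_iff field_simps)
  then show "q \<in> phi2 ` inf_face" by blast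
qed (auto intro: phi2_in_fin_face)

lemma agreeingI: "g \<in> A \<Longrightarrow> (\<And>p. p \<in> D \<Longrightarrow> f p = g p) \<Longrightarrow> f \<in> agreeing D A"
  unfolding agreeing_def by blast

lemma agreeingE:
  assumes "f \<in> agreeing D A"
  obtains g where "g \<in> A" "\<And>p. p \<in> D \<Longrightarrow> f p = g p"
  using assms unfolding agreeing_def by blast

lemma agreeing_fin_faceI:
  "g \<in> A \<Longrightarrow> (\<And>q. q \<in> inf_face \<Longrightarrow> e (phi2 q) = g (phi2 q)) \<Longrightarrow> e \<in> agreeing fin_face A"
  unfolding phi2_image[symmetric] by (auto intro: agreeingI)

lemma P2_phi2:
  assumes "g \<in> P2 (int n)"
  obtains p where "p \<in> P2 (int n)" "\<And>q. q \<in> inf_face \<Longrightarrow> g (phi2 q) = p q / (1 + q$2) ^ n"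
proof -
  have "\<exists>p\<in>P2 (int n). \<forall>q\<in>inf_face. g (phi2 q) = p q / (1 + q$2) ^ n"
    using assms
  proof (induction rule: P2_induct)
    case zero
    show ?case by (intro bexI[of _ "\<lambda>q. 0"]) auto
  next
    case (add f g)
    then obtain p r where "p \<in> P2 (int n)" "r \<in> P2 (int n)"
      "\<forall>q\<in>inf_face. f (phi2 q) = p q / (1 + q$2) ^ n" "\<forall>q\<in>inf_face. g (phi2 q) = r q / (1 + q$2) ^ n"
      by blast
    then show ?case
      by (intro bexI[of _ "\<lambda>q. p q + r q"]) (auto intro: poly_add simp: add_divide_distrib)
  next
    case (monom a i j)
    then have ij: "i + j \<le> n" by simp
    have one: "(\<lambda>q. 1 + q$2) \<in> P2 1"
      by (intro poly_add P2_const P2_coord2) auto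
    have "(\<lambda>q. a * (q$1 ^ i * q$2 ^ j * (1 + q$2) ^ (n - (i + j)))) \<in> P2 (int n)"
      by (intro poly_scale P2_mult[OF P2_monom[OF order.refl] P2_power[OF one order.refl]])
        (use ij in auto)
    moreover have "a * (phi2 q$1 ^ i * phi2 q$2 ^ j) =
        a * (q$1 ^ i * q$2 ^ j * (1 + q$2) ^ (n - (i + j))) / (1 + q$2) ^ n"
      if "q \<in> inf_face" for q
    proof -
      have "(1 + q$2) ^ n = (1 + q$2) ^ i * (1 + q$2) ^ j * (1 + q$2) ^ (n - (i + j))"
        using ij by (simp flip: power_add)
      moreover have "1 + q$2 \<noteq> 0"
        using that by (auto simp: inf_face_def)
      ultimately show ?thesis
        by (simp add: phi2_def power_divide)
    qed
    ultimately show ?case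
      by (intro bexI[of _ "\<lambda>q. a * (q$1 ^ i * q$2 ^ j * (1 + q$2) ^ (n - (i + j)))"] ballI)
  qed
  then show ?thesis using that by blast
qed

lemma P2_phi2_inverse:
  assumes "p \<in> P2 (int n)"
  obtains g where "g \<in> P2 (int n)" "\<And>q. q \<in> inf_face \<Longrightarrow> g (phi2 q) = p q / (1 + q$2) ^ n"
proof -
  have "\<exists>g\<in>P2 (int n). \<forall>q\<in>inf_face. g (phi2 q) = p q / (1 + q$2) ^ n"
    using assms
  proof (induction rule: P2_induct)
    case zero
    show ?case by (intro bexI[of _ "\<lambda>q. 0"]) auto
  next
    case (add f g)
    then obtain p r where "p \<in> P2 (int n)" "r \<in> P2 (int n)"
      "\<forall>q\<in>inf_face. p (phi2 q) = f q / (1 + q$2) ^ n" "\<forall>q\<in>inf_face. r (phi2 q) = g q / (1 + q$2) ^ n"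
      by blast
    then show ?case
      by (intro bexI[of _ "\<lambda>q. p q + r q"]) (auto intro: poly_add simp: add_divide_distrib)
  next
    case (monom a i j)
    then have ij: "i + j \<le> n" by simp
    have one: "(\<lambda>q. 1 - q$2) \<in> P2 1"
      by (intro poly_diff P2_const P2_coord2) auto
    \<comment> \<open>Every degree by which the monomial falls short of n leaves a factor 1/(1+z),
      which is the polynomial 1 - \<zeta> in finite coordinates.\<close>
    have "(\<lambda>q. a * (q$1 ^ i * q$2 ^ j * (1 - q$2) ^ (n - (i + j)))) \<in> P2 (int n)"
      by (intro poly_scale P2_mult[OF P2_monom[OF order.refl] P2_power[OF one order.refl]])
        (use ij in auto)
    moreover have "a * (phi2 q$1 ^ i * phi2 q$2 ^ j * (1 - phi2 q$2) ^ (n - (i + j))) =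
        a * (q$1 ^ i * q$2 ^ j) / (1 + q$2) ^ n"
      if "q \<in> inf_face" for q
    proof -
      have "(1 + q$2) ^ n = (1 + q$2) ^ i * (1 + q$2) ^ j * (1 + q$2) ^ (n - (i + j))"
        using ij by (simp flip: power_add)
      moreover have nz: "1 + q$2 \<noteq> 0"
        using that by (auto simp: inf_face_def)
      moreover have "1 - phi2 q$2 = 1 / (1 + q$2)"
        using nz by (simp add: phi2_def field_simps)
      ultimately show ?thesis
        by (simp add: phi2_def power_divide)
    qed
    ultimately show ?case
      by (intro bexI[of _ "\<lambda>q. a * (q$1 ^ i * q$2 ^ j * (1 - q$2) ^ (n - (i + j)))"] ballI)
  qed
  then show ?thesis using that by blast
qed

lemma agreeing_P2_phi2:
  "(\<lambda>q. e (phi2 q)) \<in> agreeing inf_face (P2w n (int n)) \<longleftrightarrow> e \<in> agreeing fin_face (P2 (int n))"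
proof
  assume "(\<lambda>q. e (phi2 q)) \<in> agreeing inf_face (P2w n (int n))"
  then obtain p where p: "p \<in> P2 (int n)" "\<And>q. q \<in> inf_face \<Longrightarrow> e (phi2 q) = p q / (1 + q$2) ^ n"
    by (auto simp: agreeing_def P2w_def)
  obtain g where "g \<in> P2 (int n)" "\<And>q. q \<in> inf_face \<Longrightarrow> g (phi2 q) = p q / (1 + q$2) ^ n"
    using P2_phi2_inverse[OF p(1)] by blast
  with p show "e \<in> agreeing fin_face (P2 (int n))"
    by (intro agreeing_fin_faceI[of g]) auto
next
  assume "e \<in> agreeing fin_face (P2 (int n))"
  then obtain g where g: "g \<in> P2 (int n)" "\<And>q. q \<in> inf_face \<Longrightarrow> e (phi2 q) = g (phi2 q)"
    unfolding agreeing_def phi2_image[symmetric] by auto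
  obtain p where "p \<in> P2 (int n)" "\<And>q. q \<in> inf_face \<Longrightarrow> g (phi2 q) = p q / (1 + q$2) ^ n"
    using P2_phi2[OF g(1)] by blast
  with g show "(\<lambda>q. e (phi2 q)) \<in> agreeing inf_face (P2w n (int n))"
    unfolding agreeing_def P2w_def by auto
qed

text \<open>This identifies the homogeneous polynomials in w and 1+z, divided by (1+z)^n, with the
  polynomials in \<xi> alone that \<open>tau1_eq\<close> contains.\<close>

lemma univariate_phi2:
  assumes "q \<in> inf_face"
  shows "(\<Sum>a\<le>n. c a * phi2 q$1 ^ a) = (\<Sum>a\<le>n. c a * q$1 ^ a * (1 + q$2) ^ (n - a)) / (1 + q$2) ^ n"
proof -
  have nz: "1 + q$2 \<noteq> 0"
    using assms by (auto simp: inf_face_def)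
  have "c a * phi2 q$1 ^ a = c a * q$1 ^ a * (1 + q$2) ^ (n - a) / (1 + q$2) ^ n" if "a \<le> n" for a
    using nz that by (simp add: phi2_def power_divide power_diff)
  then show ?thesis
    by (simp add: sum_divide_distrib)
qed

lemma tau1I:
  assumes "f \<in> P2 (int n)" "g \<in> P2 (int n)"
  shows "(\<lambda>q. vector [(1 - q$2) * f q + (\<Sum>a\<le>n. c a * q$1 ^ a), g q + q$1 * f q])
    \<in> tau1 q0 (Suc n)"
  using assms unfolding tau1_eq by blast

lemma U1_faceI:
  assumes "f \<in> P2 (int n)" "g \<in> P2 (int n)"
  shows "(\<lambda>q. vector [f q / (1 + q$2) ^ (n + 2), g q / (1 + q$2) ^ (n + 2)] +
      ((\<Sum>a\<le>n. c a * q$1 ^ a * (1 + q$2) ^ (n - a)) / (1 + q$2) ^ (n + 2)) *\<^sub>R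
        vector [1 + q$2, - q$1]) \<in> U1_face (Suc n)"
proof -
  have "(\<lambda>q. f q / (1 + q$2) ^ (n + 2)) \<in> P2w (n + 2) (int n)"
    "(\<lambda>q. g q / (1 + q$2) ^ (n + 2)) \<in> P2w (n + 2) (int n)"
    "(\<lambda>q. (\<Sum>a\<le>n. c a * q$1 ^ a * (1 + q$2) ^ (n - a)) / (1 + q$2) ^ (n + 2)) \<in> hom_w (n + 2) n"
    using assms unfolding P2w_def hom_w_def by blast+
  then show ?thesis
    unfolding U1_face_def by (auto intro!: sum_spaceI pair_spaceI)
qed

text \<open>The left-hand side is the pullback of the 1-form \<open>e\<close> under \<open>phi2\<close>.\<close>

lemma agreeing_tau1_phi2:
  "(\<lambda>q. vector [e (phi2 q) $ 1 / (1 + q$2), (e (phi2 q) $ 2 - q$1 * e (phi2 q) $ 1) / (1 + q$2)\<^sup>2])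
     \<in> agreeing inf_face (U1_face (Suc n)) \<longleftrightarrow> e \<in> agreeing fin_face (tau1 q0 (Suc n))"
  (is "?E \<in> _ \<longleftrightarrow> _")
proof
  assume "?E \<in> agreeing inf_face (U1_face (Suc n))"
  then obtain f g c where fg: "f \<in> P2 (int n)" "g \<in> P2 (int n)" and
    E: "\<And>q. q \<in> inf_face \<Longrightarrow> ?E q = vector [f q / (1 + q$2) ^ (n + 2), g q / (1 + q$2) ^ (n + 2)] +
       ((\<Sum>a\<le>n. c a * q$1 ^ a * (1 + q$2) ^ (n - a)) / (1 + q$2) ^ (n + 2)) *\<^sub>R vector [1 + q$2, - q$1]"
    unfolding agreeing_def U1_face_def sum_space_def pair_space_def P2w_def hom_w_def by auto
  obtain F where F: "F \<in> P2 (int n)" "\<And>q. q \<in> inf_face \<Longrightarrow> F (phi2 q) = f q / (1 + q$2) ^ n"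
    using P2_phi2_inverse[OF fg(1)] by blast
  obtain G where G: "G \<in> P2 (int n)" "\<And>q. q \<in> inf_face \<Longrightarrow> G (phi2 q) = g q / (1 + q$2) ^ n"
    using P2_phi2_inverse[OF fg(2)] by blast
  \<comment> \<open>Since \<xi> = w (1 - \<zeta>), the field F (1 - \<zeta>, \<xi>) pulls back to
    (F, 0)/(1+z)^2: its second component cancels. Likewise (0, G) pulls back to (0, G)/(1+z)^2 and a
    univariate (C, 0) to C (1+z, -w)/(1+z)^2. These are the three pieces of
    \<open>U1_face\<close>.\<close>
  have "e (phi2 q) = vector [(1 - phi2 q$2) * F (phi2 q) + (\<Sum>a\<le>n. c a * phi2 q$1 ^ a),
      G (phi2 q) + phi2 q$1 * F (phi2 q)]" if q: "q \<in> inf_face" for q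
  proof -
    define z where "z = 1 + q$2"
    define h where "h = (\<Sum>a\<le>n. c a * q$1 ^ a * z ^ (n - a))"
    have nz: "z \<noteq> 0"
      using q by (auto simp: inf_face_def z_def)
    have e: "e (phi2 q) $ 1 / z = f q / z ^ (n + 2) + h / z ^ (n + 2) * z"
      "(e (phi2 q) $ 2 - q$1 * e (phi2 q) $ 1) / z\<^sup>2 = g q / z ^ (n + 2) - h / z ^ (n + 2) * q$1"
      using E[OF q] by (simp_all add: vec2_eq_iff z_def h_def)
    have e1: "e (phi2 q) $ 1 = f q / z ^ (n + 1) + h / z ^ n"
      using e(1) nz by (simp add: field_simps)
    moreover have "e (phi2 q) $ 2 = g q / z ^ n - h / z ^ n * q$1 + q$1 * e (phi2 q) $ 1"
    proof -
      have "e (phi2 q) $ 2 - q$1 * e (phi2 q) $ 1 = (g q / z ^ (n + 2) - h / z ^ (n + 2) * q$1) * z\<^sup>2"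
        using e(2) nz by (simp add: field_simps)
      also have "\<dots> = g q / z ^ n - h / z ^ n * q$1"
        using nz by (simp add: field_simps power2_eq_square)
      finally show ?thesis by simp
    qed
    moreover have "1 - phi2 q$2 = 1 / z" "phi2 q$1 = q$1 / z"
      using nz by (simp_all add: phi2_def z_def field_simps)
    moreover have "(\<Sum>a\<le>n. c a * phi2 q$1 ^ a) = h / z ^ n"
      using univariate_phi2[OF q] by (simp add: z_def h_def)
    moreover have "F (phi2 q) = f q / z ^ n" "G (phi2 q) = g q / z ^ n"
      using F(2)[OF q] G(2)[OF q] by (simp_all add: z_def)
    ultimately show ?thesis
      using nz by (simp only: vec2_eq_iff vector_2) (simp add: field_simps)
  qed
  then show "e \<in> agreeing fin_face (tau1 q0 (Suc n))"
    by (rule agreeing_fin_faceI[OF tau1I[OF F(1) G(1)]])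
next
  assume "e \<in> agreeing fin_face (tau1 q0 (Suc n))"
  then obtain F G c where FG: "F \<in> P2 (int n)" "G \<in> P2 (int n)" and
    e: "\<And>q. q \<in> inf_face \<Longrightarrow> e (phi2 q) =
      vector [(1 - phi2 q$2) * F (phi2 q) + (\<Sum>a\<le>n. c a * phi2 q$1 ^ a), G (phi2 q) + phi2 q$1 * F (phi2 q)]"
    unfolding agreeing_def tau1_eq phi2_image[symmetric] by auto
  obtain f where f: "f \<in> P2 (int n)" "\<And>q. q \<in> inf_face \<Longrightarrow> F (phi2 q) = f q / (1 + q$2) ^ n"
    using P2_phi2[OF FG(1)] by blast
  obtain g where g: "g \<in> P2 (int n)" "\<And>q. q \<in> inf_face \<Longrightarrow> G (phi2 q) = g q / (1 + q$2) ^ n"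
    using P2_phi2[OF FG(2)] by blast
  have "?E q = vector [f q / (1 + q$2) ^ (n + 2), g q / (1 + q$2) ^ (n + 2)] +
       ((\<Sum>a\<le>n. c a * q$1 ^ a * (1 + q$2) ^ (n - a)) / (1 + q$2) ^ (n + 2)) *\<^sub>R vector [1 + q$2, - q$1]"
    if q: "q \<in> inf_face" for q
  proof -
    define z where "z = 1 + q$2"
    define h where "h = (\<Sum>a\<le>n. c a * q$1 ^ a * z ^ (n - a))"
    have nz: "z \<noteq> 0"
      using q by (auto simp: inf_face_def z_def)
    have phi: "1 - phi2 q$2 = 1 / z" "phi2 q$1 = q$1 / z"
      using nz by (simp_all add: phi2_def z_def field_simps)
    have univ: "(\<Sum>a\<le>n. c a * phi2 q$1 ^ a) = h / z ^ n"
      using univariate_phi2[OF q] by (simp add: z_def h_def)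
    have fg: "F (phi2 q) = f q / z ^ n" "G (phi2 q) = g q / z ^ n"
      using f(2)[OF q] g(2)[OF q] by (simp_all add: z_def)
    have e1: "e (phi2 q) $ 1 = f q / z ^ n / z + h / z ^ n"
      unfolding e[OF q] vector_2 univ unfolding fg phi by simp
    have e2: "e (phi2 q) $ 2 = g q / z ^ n + q$1 / z * (f q / z ^ n)"
      unfolding e[OF q] vector_2 fg phi by simp
    show ?thesis
      unfolding e1 e2 z_def[symmetric] h_def[symmetric] vec2_eq_iff vector_2
        vector_add_component vector_scaleR_component
      using nz by (simp add: field_simps power2_eq_square)
  qed
  then show "?E \<in> agreeing inf_face (U1_face (Suc n))"
    by (rule agreeingI[OF U1_faceI[OF f(1) g(1)]])
qed

subsection \<open>Jacobians, pullbacks and traces\<close>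

lemma has_derivative_coord [derivative_intros]:
  "((\<lambda>x. x $ i) has_derivative (\<lambda>h. h $ i)) F"
  by (rule bounded_linear_imp_has_derivative[OF bounded_linear_vec_nth])

text \<open>The derivatives of the three components determine the matrix. The dimension of the
  domain is left open so that the rule serves both \<open>phi\<close> and the charts of the
  faces.\<close>

lemma jacobian3I:
  fixes f :: "real^'n \<Rightarrow> real^3"
  assumes "((\<lambda>x. f x $ 1) has_derivative (\<lambda>h. (A *v h) $ 1)) (at x)"
    and "((\<lambda>x. f x $ 2) has_derivative (\<lambda>h. (A *v h) $ 2)) (at x)"
    and "((\<lambda>x. f x $ 3) has_derivative (\<lambda>h. (A *v h) $ 3)) (at x)"
  shows "jacobian f (at x) = A"
proof -
  have "\<forall>i. ((\<lambda>x. f x $ i) has_derivative (\<lambda>h. (A *v h) $ i)) (at x)"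
    using assms by (simp add: forall_3)
  then have "(f has_derivative (\<lambda>h. A *v h)) (at x)"
    unfolding has_derivative_componentwise_within[of f _ x UNIV]
    by (auto simp: Basis_vec_def inner_axis)
  then show ?thesis
    unfolding jacobian_def by (simp add: frechet_derivative_at[symmetric] matrix_of_matrix_vector_mul)
qed

lemma vec_mat_simps:
  "(A::real^3^3) *v x = vector [A$1$1 * x$1 + A$1$2 * x$2 + A$1$3 * x$3,
     A$2$1 * x$1 + A$2$2 * x$2 + A$2$3 * x$3, A$3$1 * x$1 + A$3$2 * x$2 + A$3$3 * x$3]"
  "(B::real^2^3) *v y = vector [B$1$1 * y$1 + B$1$2 * y$2, B$2$1 * y$1 + B$2$2 * y$2,
     B$3$1 * y$1 + B$3$2 * y$2]"
  "(C::real^3^2) *v x = vector [C$1$1 * x$1 + C$1$2 * x$2 + C$1$3 * x$3,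
     C$2$1 * x$1 + C$2$2 * x$2 + C$2$3 * x$3]"
  by (simp_all add: vec2_eq_iff vec3_eq_iff matrix_vector_mult_def sum_2 sum_3)

lemma jacobian_phi:
  assumes "p$3 \<noteq> -1"
  shows "jacobian phi (at p) =
    vector [vector [1 / (1 + p$3), 0, - p$1 / (1 + p$3)\<^sup>2],
            vector [0, 1 / (1 + p$3), - p$2 / (1 + p$3)\<^sup>2],
            vector [0, 0, 1 / (1 + p$3)\<^sup>2]]" (is "_ = ?J")
proof -
  have nz: "1 + p$3 \<noteq> 0"
    using assms by (simp add: add_eq_0_iff)
  have d: "((\<lambda>x. x$i / (1 + x$3)) has_derivative
      (\<lambda>h. h$i / (1 + p$3) - p$i / (1 + p$3)\<^sup>2 * h$3)) (at p)" for i
  proof (rule has_derivative_eq_rhs)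
    show "((\<lambda>x. x$i / (1 + x$3)) has_derivative
        (\<lambda>h. (h$i * (1 + p$3) - p$i * (0 + h$3)) / ((1 + p$3) * (1 + p$3)))) (at p)"
      by (intro derivative_intros nz)
    define z where "z = 1 + p$3"
    have "z \<noteq> 0"
      using nz by (simp add: z_def)
    then show "(\<lambda>h. (h$i * (1 + p$3) - p$i * (0 + h$3)) / ((1 + p$3) * (1 + p$3))) =
        (\<lambda>h. h$i / (1 + p$3) - p$i / (1 + p$3)\<^sup>2 * h$3)"
      unfolding z_def[symmetric] by (simp add: fun_eq_iff field_simps power2_eq_square)
  qed
  \<comment> \<open>The third component is z/(1+z) = 1 - 1/(1+z), so its two contributions collapse
    into one.\<close>
  have "(\<lambda>h::real^3. h$3 / (1 + p$3) - p$3 / (1 + p$3)\<^sup>2 * h$3) = (\<lambda>h. h$3 / (1 + p$3)\<^sup>2)"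
  proof -
    define z where "z = 1 + p$3"
    have "z \<noteq> 0" and p3: "p$3 = z - 1"
      using nz by (simp_all add: z_def)
    then show ?thesis
      unfolding z_def[symmetric] p3 by (simp add: fun_eq_iff field_simps power2_eq_square)
  qed
  then show ?thesis
    using d[of 1] d[of 2] d[of 3]
    by (intro jacobian3I) (simp_all add: phi_def vec_mat_simps)
qed

lemma pullback1_eq:
  assumes "p$3 \<noteq> -1"
  shows "pullback1 E p = vector [E (phi p)$1 / (1 + p$3), E (phi p)$2 / (1 + p$3),
    (E (phi p)$3 - p$1 * E (phi p)$1 - p$2 * E (phi p)$2) / (1 + p$3)\<^sup>2]"
  unfolding pullback1_def jacobian_phi[OF assms] vec_mat_simps
  by (simp add: transpose_def vec3_eq_iff) (simp add: diff_divide_distrib mult.commute)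

text \<open>The inverse matrix is never written down: \<open>x\<close> solves J x = w for the
  triangular J, which fixes the inverse applied to w. Multiplying by the determinant (1+z)^(-4)
  leaves the denominators (1+z)^3 and (1+z)^2.\<close>

lemma pullback2_eq:
  assumes "p$3 \<noteq> -1"
  shows "pullback2 v p = vector [(v (phi p)$1 + p$1 * v (phi p)$3) / (1 + p$3) ^ 3,
    (v (phi p)$2 + p$2 * v (phi p)$3) / (1 + p$3) ^ 3, v (phi p)$3 / (1 + p$3)\<^sup>2]"
proof -
  define z where "z = 1 + p$3"
  have nz: "z \<noteq> 0"
    using assms by (simp add: z_def add_eq_0_iff)
  define J :: "real^3^3" where "J = vector [vector [1 / z, 0, - p$1 / z\<^sup>2],
      vector [0, 1 / z, - p$2 / z\<^sup>2], vector [0, 0, 1 / z\<^sup>2]]"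
  define w where "w = v (phi p)"
  define x :: "real^3" where "x = vector [z * (w$1 + p$1 * w$3), z * (w$2 + p$2 * w$3), z\<^sup>2 * w$3]"
  have J: "jacobian phi (at p) = J"
    using jacobian_phi[OF assms] by (simp add: J_def z_def)
  have det: "det J = 1 / z ^ 4"
    by (simp add: det_3 J_def) (simp add: power4_eq_xxxx power2_eq_square)
  then have "invertible J"
    using nz by (simp add: invertible_det_nz)
  moreover have "J *v x = w"
    unfolding vec_mat_simps using nz
    by (simp add: vec3_eq_iff J_def x_def field_simps power2_eq_square)
  moreover have "matrix_inv J ** J = mat 1" if "invertible J"
    using someI_ex[OF that[unfolded invertible_def]] unfolding matrix_inv_def by blast
  ultimately have "matrix_inv J *v w = x"
    by (metis matrix_vector_mul_assoc matrix_vector_mul_lid)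
  then show ?thesis
    unfolding pullback2_def J det using nz
    by (simp add: w_def[symmetric] x_def vec3_eq_iff flip: z_def)
      (simp add: field_simps power2_eq_square power3_eq_cube power4_eq_xxxx)
qed

lemma jacobian_chart:
  "jacobian (chart S1) (at q) = vector [vector [1, 0], vector [0, 0], vector [0, 1]]"
  "jacobian (chart S2) (at q) = vector [vector [0, -1], vector [1, 0], vector [0, 1]]"
  "jacobian (chart S3) (at q) = vector [vector [1, 0], vector [0, -1], vector [0, 1]]"
  "jacobian (chart S4) (at q) = vector [vector [0, 0], vector [1, 0], vector [0, 1]]"
  "jacobian (chart Base) (at q) = vector [vector [1, 0], vector [0, 1], vector [0, 0]]"
  by (rule jacobian3I; auto simp: vec_mat_simps intro!: derivative_eq_intros)+

lemma face_dom_vertical: "F \<in> {S1, S2, S3, S4} \<Longrightarrow> face_dom F = fin_face"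
  by (auto simp: face_dom_def fin_face_def Omega_def apex_def vec3_eq_iff)

lemma face_dom_Base: "face_dom Base = {q. 0 \<le> q$1 \<and> q$1 \<le> 1 \<and> 0 \<le> q$2 \<and> q$2 \<le> 1}"
  by (auto simp: face_dom_def Omega_def apex_def vec3_eq_iff)

text \<open>On the slanted faces the second coordinate tangent is (-1, 0, 1) for \<open>S2\<close>
  and (0, -1, 1) for \<open>S3\<close>, whence the differences.\<close>

lemma trace1_eq:
  assumes "q \<in> face_dom F"
  shows "F = S1 \<Longrightarrow> trace1 F E q = vector [E (chart F q)$1, E (chart F q)$3]"
    "F = S2 \<Longrightarrow> trace1 F E q = vector [E (chart F q)$2, E (chart F q)$3 - E (chart F q)$1]"
    "F = S3 \<Longrightarrow> trace1 F E q = vector [E (chart F q)$1, E (chart F q)$3 - E (chart F q)$2]"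
    "F = S4 \<Longrightarrow> trace1 F E q = vector [E (chart F q)$2, E (chart F q)$3]"
    "F = Base \<Longrightarrow> trace1 F E q = vector [E (chart F q)$1, E (chart F q)$2]"
  using assms unfolding trace1_def
  by (simp_all add: jacobian_chart vec_mat_simps transpose_def vec2_eq_iff del: chart.simps)

lemma trace2_eq:
  assumes "q \<in> face_dom F"
  shows "F = S1 \<Longrightarrow> trace2 F v q = - v (chart F q)$2"
    "F = S2 \<Longrightarrow> trace2 F v q = v (chart F q)$1 + v (chart F q)$3"
    "F = S3 \<Longrightarrow> trace2 F v q = - (v (chart F q)$2 + v (chart F q)$3)"
    "F = S4 \<Longrightarrow> trace2 F v q = v (chart F q)$1"
    "F = Base \<Longrightarrow> trace2 F v q = v (chart F q)$3"
  using assms unfolding trace2_def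
  by (simp_all add: jacobian_chart column_def cross3_simps vec2_eq_iff del: chart.simps)

text \<open>The pairing is dictated by \<open>phi\<close>: the faces x = 1 and y = 1 become the
  slanted ones, and the base is fixed pointwise.\<close>

fun inf_chart :: "face \<Rightarrow> real^2 \<Rightarrow> real^3" where
  "inf_chart S1 = face_y 0"
| "inf_chart S2 = face_x 1"
| "inf_chart S3 = face_y 1"
| "inf_chart S4 = face_x 0"
| "inf_chart Base = (\<lambda>q. vector [q$1, q$2, 0])"

lemma chart_phi2:
  assumes "F \<in> {S1, S2, S3, S4}" "q \<in> inf_face"
  shows "chart F (phi2 q) = phi (inf_chart F q)"
proof -
  have "1 - phi2 q$2 = 1 / (1 + q$2)"
    using assms(2) by (simp add: phi2_def inf_face_def field_simps)
  then show ?thesis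
    using assms(1) by (auto simp: vec3_eq_iff phi_def face_x_def face_y_def) (auto simp: phi2_def)
qed

section \<open>Partial derivatives of polynomials in two variables\<close>

lemma partial_eqI: "(f has_derivative f') (at q) \<Longrightarrow> partial i f q = f' (axis i 1)"
  unfolding partial_def by (simp add: frechet_derivative_at[symmetric])

lemma Q2_partial:
  assumes "f \<in> Q2 m n"
  shows "f differentiable at q" "partial 1 f \<in> Q2 (m - 1) n" "partial 2 f \<in> Q2 m (n - 1)"
proof -
  have "(\<forall>q. f differentiable at q) \<and> partial 1 f \<in> Q2 (m - 1) n \<and> partial 2 f \<in> Q2 m (n - 1)"
    using assms
  proof (induction rule: Q2_induct)
    case zero
    have "partial i (\<lambda>q. 0) = (\<lambda>q. 0)" for i
      by (simp add: fun_eq_iff partial_eqI[OF has_derivative_const])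
    then show ?case by simp
  next
    case (add f g)
    have "partial i (\<lambda>q. f q + g q) = (\<lambda>q. partial i f q + partial i g q)" for i
    proof
      fix q
      have "(f has_derivative frechet_derivative f (at q)) (at q)"
        "(g has_derivative frechet_derivative g (at q)) (at q)"
        using add by (simp_all add: frechet_derivative_works)
      from partial_eqI[OF has_derivative_add[OF this], of i]
      show "partial i (\<lambda>q. f q + g q) q = partial i f q + partial i g q"
        by (simp add: partial_def)
    qed
    then show ?case
      using add by (auto intro: poly_add)
  next
    case (monom a i j)
    have deriv: "((\<lambda>q. a * (q$1 ^ i * q$2 ^ j)) has_derivative
        (\<lambda>h. a * (q$1 ^ i * (of_nat j * h$2 * q$2 ^ (j - 1)) + of_nat i * h$1 * q$1 ^ (i - 1) * q$2 ^ j)))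
        (at q)" for q :: "real^2"
      by (intro derivative_intros)
    have "partial 1 (\<lambda>q. a * (q$1 ^ i * q$2 ^ j)) = (\<lambda>q. (a * of_nat i) * (q$1 ^ (i - 1) * q$2 ^ j))"
      "partial 2 (\<lambda>q. a * (q$1 ^ i * q$2 ^ j)) = (\<lambda>q. (a * of_nat j) * (q$1 ^ i * q$2 ^ (j - 1)))"
      by (simp_all add: fun_eq_iff partial_eqI[OF deriv] axis_def)
    \<comment> \<open>For i = 0 the truncated exponent \<open>i - 1\<close> could violate the bound
      m - 1, which may be negative; the factor i then removes the term.\<close>
    moreover have "(\<lambda>q. (a * of_nat i) * (q$1 ^ (i - 1) * q$2 ^ j)) \<in> Q2 (m - 1) n"
    proof (cases "i = 0")
      case False
      then show ?thesis
        using monom by (intro poly_scale Q2_monom) auto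
    qed simp
    moreover have "(\<lambda>q. (a * of_nat j) * (q$1 ^ i * q$2 ^ (j - 1))) \<in> Q2 m (n - 1)"
    proof (cases "j = 0")
      case False
      then show ?thesis
        using monom by (intro poly_scale Q2_monom) auto
    qed simp
    moreover have "(\<lambda>q. a * (q$1 ^ i * q$2 ^ j)) differentiable at q" for q :: "real^2"
      unfolding differentiable_def by (rule exI, rule deriv)
    ultimately show ?case
      by simp
  qed
  then show "f differentiable at q" "partial 1 f \<in> Q2 (m - 1) n" "partial 2 f \<in> Q2 m (n - 1)"
    by blast+
qed

subsection \<open>Exchange of the horizontal coordinates\<close>

definition swap2 :: "real^2 \<Rightarrow> real^2" where
  "swap2 q = vector [q$2, q$1]"

definition swap3 :: "real^3 \<Rightarrow> real^3" where
  "swap3 p = vector [p$2, p$1, p$3]"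

lemma swap3_simps [simp]:
  "swap3 (face_x c q) = face_y c q" "swap3 (face_y c q) = face_x c q"
  "swap3 p $ 1 = p$2" "swap3 p $ 2 = p$1" "swap3 p $ 3 = p$3"
  "swap3 p \<in> Omega_inf \<longleftrightarrow> p \<in> Omega_inf" "xy (swap3 p) = swap2 (xy p)"
  by (auto simp: swap3_def face_x_def face_y_def vec3_eq_iff vec2_eq_iff Omega_inf_def xy_def swap2_def)

lemma Q2_swap: "f \<in> Q2 m n \<Longrightarrow> (\<lambda>q. f (swap2 q)) \<in> Q2 n m"
proof (induction rule: Q2_induct)
  case (monom a i j)
  then show ?case
    using poly_scale(2)[OF Q2_monom[of j n i m], of a] by (simp add: swap2_def mult.commute)
qed (auto intro: poly_add)

lemma Q3_swap: "f \<in> Q3 l m n \<Longrightarrow> (\<lambda>p. f (swap3 p)) \<in> Q3 m l n"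
proof (induction rule: Q3_induct)
  case (monom a h i j)
  then show ?case
    using poly_scale(3)[OF Q3_monom[of i m h l j n], of a] by (simp add: mult_ac)
qed (auto intro: poly_add)

lemma Q3w_swap:
  assumes "f \<in> Q3w k l m n"
  shows "(\<lambda>p. f (swap3 p)) \<in> Q3w k m l n"
proof -
  obtain g where "g \<in> Q3 l m n" "f = (\<lambda>p. g p / (1 + p$3) ^ k)"
    using assms unfolding Q3w_def by blast
  then show ?thesis
    unfolding Q3w_def using Q3_swap[of g l m n] by auto
qed

lemma partial_swap:
  assumes "r \<in> Q2 m n"
  shows "partial 1 (\<lambda>q. r (swap2 q)) q = partial 2 r (swap2 q)"
    and "partial 2 (\<lambda>q. r (swap2 q)) q = partial 1 r (swap2 q)"
proof -
  have "linear swap2"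
    by (rule linearI) (simp_all add: swap2_def vec2_eq_iff)
  then have "(swap2 has_derivative swap2) (at q)"
    by (simp add: linear_imp_has_derivative)
  moreover have "(r has_derivative frechet_derivative r (at (swap2 q))) (at (swap2 q))"
    using Q2_partial(1)[OF assms] by (simp add: frechet_derivative_works)
  ultimately have "((\<lambda>q. r (swap2 q)) has_derivative (\<lambda>h. frechet_derivative r (at (swap2 q)) (swap2 h))) (at q)"
    using diff_chain_at[of swap2 swap2 q r] by (simp add: o_def)
  moreover have "swap2 (axis 1 1) = axis 2 1" "swap2 (axis 2 1) = axis 1 1"
    by (simp_all add: swap2_def vec2_eq_iff axis_def)
  ultimately show "partial 1 (\<lambda>q. r (swap2 q)) q = partial 2 r (swap2 q)"
    "partial 2 (\<lambda>q. r (swap2 q)) q = partial 1 r (swap2 q)"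
    by (simp_all add: partial_eqI) (simp_all add: partial_def)
qed

text \<open>The map \<open>T\<close> acts on the values: the identity for scalars,
  \<open>swap3\<close> for vector fields.\<close>

lemma agreeing_swap:
  assumes "\<And>g. g \<in> A \<Longrightarrow> (\<lambda>p. T (g (swap3 p))) \<in> B" "u \<in> agreeing Omega_inf A"
  shows "(\<lambda>p. T (u (swap3 p))) \<in> agreeing Omega_inf B"
  using assms(2)
proof (rule agreeingE)
  fix g assume "g \<in> A" "\<And>p. p \<in> Omega_inf \<Longrightarrow> u p = g p"
  then show ?thesis
    by (intro agreeingI[OF assms(1)]) auto
qed

lemma U0_inf_swap:
  assumes "u \<in> U0_inf k"
  shows "(\<lambda>p. u (swap3 p)) \<in> U0_inf k"
proof -
  let ?A = "Q3w k (int k) (int k) (int k - 1) \<oplus>\<^sub>F {\<lambda>p. c * (p$3 ^ k / (1 + p$3) ^ k) | c. True}"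
  have "(\<lambda>p. g (swap3 p)) \<in> ?A" if g_in: "g \<in> ?A" for g
  proof -
    obtain f c where f: "f \<in> Q3w k (int k) (int k) (int k - 1)"
      and g: "g = (\<lambda>p. f p + c * (p$3 ^ k / (1 + p$3) ^ k))"
      using g_in unfolding sum_space_def by blast
    have "(\<lambda>p::real^3. c * (p$3 ^ k / (1 + p$3) ^ k)) \<in> {\<lambda>p. c * (p$3 ^ k / (1 + p$3) ^ k) | c. True}"
      by blast
    from sum_spaceI[OF Q3w_swap[OF f] this] show ?thesis
      by (simp add: g)
  qed
  then have "u \<in> agreeing Omega_inf ?A \<Longrightarrow> (\<lambda>p. u (swap3 p)) \<in> agreeing Omega_inf ?A"
    by (rule agreeing_swap[where T = "\<lambda>x. x" and u = u])
  with assms show ?thesis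
    unfolding U0_inf_def mem_Collect_eq by simp
qed

text \<open>This is the pullback of the 1-form under the exchange of x and y. The conditions on y =
  c and x = c trade places, and r passes to its composition with \<open>swap2\<close>.\<close>

lemma U1_inf_swap:
  assumes "u \<in> U1_inf k"
  shows "(\<lambda>p. swap3 (u (swap3 p))) \<in> U1_inf k"
proof -
  let ?A = "triple_space (Q3w (k + 1) (int k - 1) (int k) (int k - 1))
                     (Q3w (k + 1) (int k) (int k - 1) (int k - 1))
                     (Q3w (k + 1) (int k) (int k) (int k - 2)) \<oplus>\<^sub>F U1_extra k"
  have "(\<lambda>p. swap3 (g (swap3 p))) \<in> ?A" if g_in: "g \<in> ?A" for g
  proof -
    obtain f1 f2 f3 r where f: "f1 \<in> Q3w (k + 1) (int k - 1) (int k) (int k - 1)"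
        "f2 \<in> Q3w (k + 1) (int k) (int k - 1) (int k - 1)"
        "f3 \<in> Q3w (k + 1) (int k) (int k) (int k - 2)"
      and r: "r \<in> Q2 (int k) (int k)"
      and g: "g = (\<lambda>p. vector [f1 p, f2 p, f3 p] + (p$3 ^ (k - 1) / (1 + p$3) ^ (k + 1)) *\<^sub>R
        vector [partial 1 r (xy p) * p$3, partial 2 r (xy p) * p$3, - r (xy p)])"
      using g_in unfolding sum_space_def triple_space_def U1_extra_def by blast
    define r' where "r' = (\<lambda>q. r (swap2 q))"
    have "(\<lambda>p. swap3 (g (swap3 p))) = (\<lambda>p. vector [f2 (swap3 p), f1 (swap3 p), f3 (swap3 p)] +
        (p$3 ^ (k - 1) / (1 + p$3) ^ (k + 1)) *\<^sub>R
        vector [partial 1 r' (xy p) * p$3, partial 2 r' (xy p) * p$3, - r' (xy p)])"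
      by (simp add: g r'_def partial_swap[OF r] fun_eq_iff vec3_eq_iff)
    moreover have "(\<lambda>p. (p$3 ^ (k - 1) / (1 + p$3) ^ (k + 1)) *\<^sub>R
        vector [partial 1 r' (xy p) * p$3, partial 2 r' (xy p) * p$3, - r' (xy p)]) \<in> U1_extra k"
      unfolding U1_extra_def using Q2_swap[OF r] by (auto simp: r'_def)
    ultimately show ?thesis
      using sum_spaceI[OF triple_spaceI[OF Q3w_swap[OF f(2)] Q3w_swap[OF f(1)] Q3w_swap[OF f(3)]]]
      by simp
  qed
  then have "u \<in> agreeing Omega_inf ?A \<Longrightarrow> (\<lambda>p. swap3 (u (swap3 p))) \<in> agreeing Omega_inf ?A"
    by (rule agreeing_swap[where T = swap3 and u = u])
  with assms show ?thesis
    unfolding U1_inf_def mem_Collect_eq by simp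
qed

text \<open>The exchange reverses orientation, so the pullback of a 2-form would carry a further
  sign; permuting the components of the proxy suffices for membership. The two extra summands trade
  places.\<close>

lemma U2_inf_swap:
  assumes "u \<in> U2_inf k"
  shows "(\<lambda>p. swap3 (u (swap3 p))) \<in> U2_inf k"
proof -
  let ?A = "triple_space (Q3w (k + 2) (int k) (int k - 1) (int k - 2))
                     (Q3w (k + 2) (int k - 1) (int k) (int k - 2))
                     (Q3w (k + 2) (int k - 1) (int k - 1) (int k - 1))
        \<oplus>\<^sub>F U2_extra_s k \<oplus>\<^sub>F U2_extra_t k"
  have "(\<lambda>p. swap3 (g (swap3 p))) \<in> ?A" if g_in: "g \<in> ?A" for g
  proof -
    obtain f1 f2 f3 s t where f: "f1 \<in> Q3w (k + 2) (int k) (int k - 1) (int k - 2)"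
        "f2 \<in> Q3w (k + 2) (int k - 1) (int k) (int k - 2)"
        "f3 \<in> Q3w (k + 2) (int k - 1) (int k - 1) (int k - 1)"
      and st: "s \<in> Q2 (int k - 1) (int k)" "t \<in> Q2 (int k) (int k - 1)"
      and g: "g = (\<lambda>p. vector [f1 p, f2 p, f3 p] + (p$3 ^ (k - 1) / (1 + p$3) ^ (k + 2)) *\<^sub>R
          vector [0, 2 * s (xy p), partial 2 s (xy p) * (1 + p$3)] +
          (p$3 ^ (k - 1) / (1 + p$3) ^ (k + 2)) *\<^sub>R
          vector [2 * t (xy p), 0, partial 1 t (xy p) * (1 + p$3)])"
      using g_in unfolding sum_space_def triple_space_def U2_extra_s_def U2_extra_t_def by blast
    define s' t' where "s' = (\<lambda>q. t (swap2 q))" and "t' = (\<lambda>q. s (swap2 q))"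
    have "(\<lambda>p. swap3 (g (swap3 p))) = (\<lambda>p. vector [f2 (swap3 p), f1 (swap3 p), f3 (swap3 p)] +
          (p$3 ^ (k - 1) / (1 + p$3) ^ (k + 2)) *\<^sub>R
          vector [0, 2 * s' (xy p), partial 2 s' (xy p) * (1 + p$3)] +
          (p$3 ^ (k - 1) / (1 + p$3) ^ (k + 2)) *\<^sub>R
          vector [2 * t' (xy p), 0, partial 1 t' (xy p) * (1 + p$3)])"
      by (simp add: g s'_def t'_def partial_swap[OF st(1)] partial_swap[OF st(2)] fun_eq_iff vec3_eq_iff)
    moreover have "(\<lambda>p. (p$3 ^ (k - 1) / (1 + p$3) ^ (k + 2)) *\<^sub>R
        vector [0, 2 * s' (xy p), partial 2 s' (xy p) * (1 + p$3)]) \<in> U2_extra_s k"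
      unfolding U2_extra_s_def using Q2_swap[OF st(2)] by (auto simp: s'_def)
    moreover have "(\<lambda>p. (p$3 ^ (k - 1) / (1 + p$3) ^ (k + 2)) *\<^sub>R
        vector [2 * t' (xy p), 0, partial 1 t' (xy p) * (1 + p$3)]) \<in> U2_extra_t k"
      unfolding U2_extra_t_def using Q2_swap[OF st(1)] by (auto simp: t'_def)
    ultimately show ?thesis
      using sum_spaceI[OF sum_spaceI[OF
          triple_spaceI[OF Q3w_swap[OF f(2)] Q3w_swap[OF f(1)] Q3w_swap[OF f(3)]]]]
      by simp
  qed
  then have "u \<in> agreeing Omega_inf ?A \<Longrightarrow> (\<lambda>p. swap3 (u (swap3 p))) \<in> agreeing Omega_inf ?A"
    by (rule agreeing_swap[where T = swap3 and u = u])
  with assms show ?thesis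
    unfolding U2_inf_def mem_Collect_eq by simp
qed

subsection \<open>Extension from a vertical face\<close>

text \<open>Among the monomials of total degree at most n only z^n has degree n in z, so one
  coefficient is all that a tensor-product space with z-degree n - 1 misses.\<close>

lemma P2_split_top:
  assumes "f \<in> P2 (int n)"
  obtains g b where "g \<in> Q2 (int n) (int n - 1)" "\<And>q. f q = g q + b * q$2 ^ n"
proof -
  have "\<exists>g b. g \<in> Q2 (int n) (int n - 1) \<and> (\<forall>q. f q = g q + b * q$2 ^ n)"
    using assms
  proof (induction rule: P2_induct)
    case zero
    show ?case by (intro exI[of _ "\<lambda>q. 0"] exI[of _ 0]) simp
  next
    case (add f g)
    then obtain f' b g' c where "f' \<in> Q2 (int n) (int n - 1)" "g' \<in> Q2 (int n) (int n - 1)"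
      and fg: "\<And>q. f q = f' q + b * q$2 ^ n" "\<And>q. g q = g' q + c * q$2 ^ n"
      by blast
    then show ?case
      by (intro exI[of _ "\<lambda>q. f' q + g' q"] exI[of _ "b + c"]) (auto intro: poly_add simp: fg algebra_simps)
  next
    case (monom a i j)
    show ?case
    proof (cases "j = n")
      case True
      then show ?thesis
        using monom by (intro exI[of _ "\<lambda>q. 0"] exI[of _ a]) simp
    next
      case False
      then have "(\<lambda>q. a * (q$1 ^ i * q$2 ^ j)) \<in> Q2 (int n) (int n - 1)"
        using monom by (intro poly_scale Q2_monom) auto
      then show ?thesis
        by (intro exI[of _ "\<lambda>q. a * (q$1 ^ i * q$2 ^ j)"] exI[of _ 0]) simp
    qed
  qed
  then show ?thesis using that by blast
qed

lemma Q2_mono: "f \<in> Q2 m n \<Longrightarrow> m \<le> m' \<Longrightarrow> n \<le> n' \<Longrightarrow> f \<in> Q2 m' n'"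
  by (induction rule: Q2_induct) (auto intro!: poly_add poly_scale Q2_monom)

lemma Q2_mult_coord:
  shows "f \<in> Q2 m n \<Longrightarrow> (\<lambda>q. q$1 * f q) \<in> Q2 (m + 1) n"
    and "f \<in> Q2 m n \<Longrightarrow> (\<lambda>q. q$2 * f q) \<in> Q2 m (n + 1)"
proof (induction rule: Q2_induct)
  case (monom a i j)
  { case 1 show ?case
      using poly_scale(2)[OF Q2_monom[of "Suc i" "m + 1" j n], of a] monom by (simp add: mult_ac)
  next
    case 2 show ?case
      using poly_scale(2)[OF Q2_monom[of i m "Suc j" "n + 1"], of a] monom by (simp add: mult_ac) }
qed (auto simp: distrib_left intro: poly_add)

lemma Q2_extend_affine:
  assumes "g \<in> Q2 l n" "1 \<le> m"
  shows "(\<lambda>p. (a + b * p$2) * g (vector [p$1, p$3])) \<in> Q3 l m n"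
  using assms(1)
proof (induction rule: Q2_induct)
  case (add f g)
  then show ?case by (simp add: distrib_left poly_add)
next
  case (monom d i j)
  have "(\<lambda>p. (d * a) * (p$1 ^ i * p$2 ^ 0 * p$3 ^ j) + (d * b) * (p$1 ^ i * p$2 ^ 1 * p$3 ^ j)) \<in> Q3 l m n"
    using monom assms(2) by (intro poly_add poly_scale Q3_monom) auto
  then show ?case by (simp add: algebra_simps)
qed simp

text \<open>On an adjacent face the first variable of \<open>g\<close> is frozen, and the cutoff
  adds one degree in w to the z-degree n. The bound n + 1 on the total degree is thus independent of
  \<open>l\<close>.\<close>

lemma Q2_restrict_affine:
  assumes "g \<in> Q2 l n" "n + 1 \<le> d"
  shows "(\<lambda>q. (a + b * q$1) * g (vector [c, q$2])) \<in> P2 d"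
  using assms(1)
proof (induction rule: Q2_induct)
  case (add f g)
  then show ?case by (simp add: distrib_left poly_add)
next
  case (monom e i j)
  have "(\<lambda>q. (e * c ^ i * a) * (q$1 ^ 0 * q$2 ^ j) + (e * c ^ i * b) * (q$1 ^ 1 * q$2 ^ j)) \<in> P2 d"
    using monom assms(2) by (intro poly_add poly_scale P2_monom) auto
  then show ?case by (simp add: algebra_simps)
qed simp

lemma P2wI: "f \<in> P2 n \<Longrightarrow> (\<lambda>q. f q / (1 + q$2) ^ k) \<in> P2w k n"
  unfolding P2w_def by blast

lemma Q3wI: "f \<in> Q3 l m n \<Longrightarrow> (\<lambda>p. f p / (1 + p$3) ^ k) \<in> Q3w k l m n"
  unfolding Q3w_def by blast

lemma space_zero [simp]: "(\<lambda>q. 0) \<in> P2w k n" "(\<lambda>p. 0) \<in> Q3w k l m n"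
  using P2wI[of "\<lambda>q. 0" n k] Q3wI[of "\<lambda>p. 0" l m n k] by simp_all

lemma face_simps [simp]:
  "face_x c q $ 1 = c" "face_x c q $ 2 = q$1" "face_x c q $ 3 = q$2"
  "face_y c q $ 1 = q$1" "face_y c q $ 2 = c" "face_y c q $ 3 = q$2"
  "xy (face_x c q) = vector [c, q$1]" "xy (face_y c q) = vector [q$1, c]"
  "vector [q$1, q$2] = q"
  by (simp_all add: face_x_def face_y_def xy_def vec2_eq_iff)

lemma agreeing_self: "f \<in> A \<Longrightarrow> f \<in> agreeing D A"
  by (rule agreeingI) auto

lemma affine_cutoff:
  assumes "c \<in> {0, 1::real}"
  obtains a b :: real where "a + b * c = 1" "\<And>d. d \<in> {0, 1} \<Longrightarrow> d \<noteq> c \<Longrightarrow> a + b * d = 0"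
proof (cases "c = 0")
  case True
  then show ?thesis using that[of 1 "-1"] by auto
next
  case False
  then show ?thesis using that[of 0 1] assms by auto
qed

lemma U0_inf_extend:
  assumes f: "f \<in> P2w k (int k)" and "k \<ge> 1" and c: "c \<in> {0, 1}"
  obtains u where "u \<in> U0_inf k" "\<And>q. u (face_y c q) = f q"
proof -
  obtain F where F: "F \<in> P2 (int k)" and f_eq: "f = (\<lambda>q. F q / (1 + q$2) ^ k)"
    using f unfolding P2w_def by blast
  obtain g e where g: "g \<in> Q2 (int k) (int k - 1)" and F_eq: "\<And>q. F q = g q + e * q$2 ^ k"
    using P2_split_top[OF F] by blast
  obtain a b where ab: "a + b * c = 1" "\<And>d. d \<in> {0, 1} \<Longrightarrow> d \<noteq> c \<Longrightarrow> a + b * d = 0"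
    using affine_cutoff[OF c] by blast
  \<comment> \<open>The top term is not cut off, as its carrier z^k/(1+z)^k does not depend on x and
    y. The trace that it leaves on the opposite face is admissible there.\<close>
  define u where "u p = (a + b * p$2) * g (vector [p$1, p$3]) / (1 + p$3) ^ k +
      e * (p$3 ^ k / (1 + p$3) ^ k)" for p :: "real^3"
  have top: "(\<lambda>q. e * q$2 ^ k) \<in> P2 (int k)"
    using poly_scale(1)[OF P2_monom[of 0 k "int k"], of e] by simp
  have face_c: "u (face_y c q) = f q" for q
    by (simp add: u_def ab f_eq F_eq add_divide_distrib)
  have "u \<in> Q3w k (int k) (int k) (int k - 1) \<oplus>\<^sub>F {\<lambda>p. c * (p$3 ^ k / (1 + p$3) ^ k) | c. True}"
    unfolding u_def using assms(2) by (intro sum_spaceI Q3wI Q2_extend_affine g) auto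
  moreover have "(\<lambda>q. u (face_y d q)) \<in> P2w k (int k)" if "d \<in> {0, 1}" for d
  proof (cases "d = c")
    case True
    then show ?thesis using f face_c by simp
  next
    case False
    then have "(\<lambda>q. u (face_y d q)) = (\<lambda>q. e * q$2 ^ k / (1 + q$2) ^ k)"
      using ab(2) that by (simp add: u_def)
    then show ?thesis using P2wI[OF top] by simp
  qed
  moreover have "(\<lambda>q. u (face_x d q)) \<in> P2w k (int k)" for d
  proof -
    have "(\<lambda>q. ((a + b * q$1) * g (vector [d, q$2]) + e * q$2 ^ k) / (1 + q$2) ^ k) \<in> P2w k (int k)"
      by (intro P2wI poly_add top Q2_restrict_affine[OF g]) simp
    then show ?thesis by (simp add: u_def add_divide_distrib)
  qed
  ultimately have "u \<in> U0_inf k"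
    unfolding U0_inf_def by (simp add: agreeing_self)
  then show ?thesis using that face_c by blast
qed

text \<open>
  The terms of maximal degree in \<open>z\<close> are those of the extra part of the 1-form space, with
  \<open>r = c x - b\<close> on the face.
\<close>

lemma U1_face_split_top:
  assumes "f \<in> U1_face (Suc n)"
  obtains A B b c where "A \<in> Q2 (int n) (int n)" "B \<in> Q2 (int n + 1) (int n - 1)"
    "\<And>q. f q = vector [(A q + c * q$2 ^ Suc n) / (1 + q$2) ^ (n + 2),
      (B q - (c * q$1 - b) * q$2 ^ n) / (1 + q$2) ^ (n + 2)]"
proof -
  obtain f1 f3 c where f13: "f1 \<in> P2 (int n)" "f3 \<in> P2 (int n)" and f: "f = (\<lambda>q.
      vector [f1 q / (1 + q$2) ^ (n + 2), f3 q / (1 + q$2) ^ (n + 2)] +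
      ((\<Sum>a\<le>n. c a * q$1 ^ a * (1 + q$2) ^ (n - a)) / (1 + q$2) ^ (n + 2)) *\<^sub>R vector [1 + q$2, - q$1])"
    using assms unfolding U1_face_def sum_space_def pair_space_def P2w_def hom_w_def by auto
  define h where "h q = (\<Sum>a\<le>n. c a * q$1 ^ a * (1 + q$2) ^ (n - a))" for q :: "real^2"
  have "h \<in> P2 (int n)"
  proof -
    have one: "(\<lambda>q. 1 + q$2) \<in> P2 1"
      by (intro poly_add P2_const P2_coord2) auto
    have "m \<le> Suc n \<Longrightarrow> (\<lambda>q. \<Sum>a<m. c a * (q$1 ^ a * q$2 ^ 0 * (1 + q$2) ^ (n - a))) \<in> P2 (int n)" for m
    proof (induction m)
      case (Suc m)
      then show ?case
        unfolding sum.lessThan_Suc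
        by (intro poly_add poly_scale P2_mult[OF P2_monom[OF order.refl] P2_power[OF one order.refl]]) auto
    qed simp
    from this[of "Suc n"] show ?thesis
      by (simp add: h_def[abs_def] lessThan_Suc_atMost mult.assoc)
  qed
  then obtain g b where g: "g \<in> Q2 (int n) (int n - 1)" and h_eq: "\<And>q. h q = g q + b * q$2 ^ n"
    using P2_split_top by blast
  obtain g1 b1 where g1: "g1 \<in> Q2 (int n) (int n - 1)" and f1_eq: "\<And>q. f1 q = g1 q + b1 * q$2 ^ n"
    using P2_split_top[OF f13(1)] by blast
  obtain g3 b3 where g3: "g3 \<in> Q2 (int n) (int n - 1)" and f3_eq: "\<And>q. f3 q = g3 q + b3 * q$2 ^ n"
    using P2_split_top[OF f13(2)] by blast
  \<comment> \<open>Multiplied by 1+z, the top term b z^n of \<open>h\<close> yields b z^n, which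
    \<open>A\<close> keeps, and b z^(n+1); multiplied by -w it yields -b w z^n. The last two share
    the coefficient b, so one affine r accounts for both. The constant term of r comes from the top
    term of \<open>f3\<close>.\<close>
  define A where "A q = (g1 q + g q) + (b1 + b) * (q$1 ^ 0 * q$2 ^ n) + q$2 * g q" for q
  define B where "B q = g3 q - q$1 * g q" for q
  have "A \<in> Q2 (int n) (int n)"
    unfolding A_def
    using Q2_mult_coord(2)[OF g] by (intro poly_add poly_scale Q2_monom Q2_mono[OF g1] Q2_mono[OF g]) auto
  moreover have "B \<in> Q2 (int n + 1) (int n - 1)"
    unfolding B_def by (intro poly_diff Q2_mult_coord(1) g Q2_mono[OF g3]) auto
  moreover have "f q = vector [(A q + b * q$2 ^ Suc n) / (1 + q$2) ^ (n + 2),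
      (B q - (b * q$1 - b3) * q$2 ^ n) / (1 + q$2) ^ (n + 2)]" for q
  proof -
    have "f1 q + h q * (1 + q$2) = A q + b * q$2 ^ Suc n"
      "f3 q - h q * q$1 = B q - (b * q$1 - b3) * q$2 ^ n"
      by (simp_all add: f1_eq f3_eq h_eq A_def B_def algebra_simps)
    then show ?thesis
      by (simp add: f h_def[symmetric] vec2_eq_iff add_divide_distrib[symmetric]
          diff_divide_distrib[symmetric] del: power_Suc power_Suc2)
  qed
  ultimately show ?thesis using that by blast
qed

lemma zero_U1_face: "(\<lambda>q. vector [0, 0]) \<in> U1_face (Suc n)"
  using U1_faceI[of "\<lambda>q. 0" n "\<lambda>q. 0" "\<lambda>a. 0"] by simp

text \<open>The cutoff is built into r as well, so that r vanishes on the opposite face together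
  with r_x. On an adjacent face x = d the extra part becomes (m b z^(n+1), -m (a + b w) z^n) with m
  = e d - s, up to the denominator. Subtracting m b (1+z)^n (1+z, -w) from it leaves degree n in
  both components.\<close>

lemma U1_inf_extend:
  assumes f: "f \<in> U1_face (Suc n)" and c: "c \<in> {0, 1}"
  obtains u where "u \<in> U1_inf (Suc n)"
    "\<And>q. vector [u (face_y c q) $ 1, u (face_y c q) $ 3] = f q"
proof -
  obtain A B s e where A: "A \<in> Q2 (int n) (int n)" and B: "B \<in> Q2 (int n + 1) (int n - 1)"
    and f_eq: "\<And>q. f q = vector [(A q + e * q$2 ^ Suc n) / (1 + q$2) ^ (n + 2),
      (B q - (e * q$1 - s) * q$2 ^ n) / (1 + q$2) ^ (n + 2)]"
    by (rule U1_face_split_top[OF f], rule that)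
  obtain a b where ab: "a + b * c = 1" "\<And>d. d \<in> {0, 1} \<Longrightarrow> d \<noteq> c \<Longrightarrow> a + b * d = 0"
    using affine_cutoff[OF c] by blast
  define r where "r q = (e * q$1 - s) * (a + b * q$2)" for q :: "real^2"
  have r: "r \<in> Q2 (int (Suc n)) (int (Suc n))"
  proof -
    have "(\<lambda>q::real^2. (e * a) * (q$1 ^ 1 * q$2 ^ 0) + (e * b) * (q$1 ^ 1 * q$2 ^ 1) +
        (- s * a) * (q$1 ^ 0 * q$2 ^ 0) + (- s * b) * (q$1 ^ 0 * q$2 ^ 1)) \<in> Q2 (int (Suc n)) (int (Suc n))"
      by (intro poly_add poly_scale Q2_monom) auto
    then show ?thesis
      by (simp add: r_def[abs_def] algebra_simps)
  qed
  have deriv: "(r has_derivative (\<lambda>h. (e * q$1 - s) * (b * h$2) + e * h$1 * (a + b * q$2))) (at q)" for q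
    unfolding r_def by (auto intro!: derivative_eq_intros)
  have partial_r: "partial 1 r q = e * (a + b * q$2)" "partial 2 r q = (e * q$1 - s) * b" for q
    by (simp_all add: partial_eqI[OF deriv] axis_def)
  define u :: "real^3 \<Rightarrow> real^3" where "u p = vector [(a + b * p$2) * A (vector [p$1, p$3]) / (1 + p$3) ^ (n + 2), 0,
      (a + b * p$2) * B (vector [p$1, p$3]) / (1 + p$3) ^ (n + 2)] +
      (p$3 ^ n / (1 + p$3) ^ (n + 2)) *\<^sub>R
        vector [partial 1 r (xy p) * p$3, partial 2 r (xy p) * p$3, - r (xy p)]" for p :: "real^3"
  have face_c: "vector [u (face_y c q) $ 1, u (face_y c q) $ 3] = f q" for q
  proof -
    have "r (vector [q$1, c]) = e * q$1 - s"
      using ab(1) by (simp add: r_def)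
    then show ?thesis
      by (simp add: u_def f_eq partial_r ab(1) vec2_eq_iff add_divide_distrib diff_divide_distrib)
        (simp add: minus_divide_left algebra_simps)
  qed
  have "u \<in> triple_space (Q3w (n + 2) (int n) (int n + 1) (int n))
                     (Q3w (n + 2) (int n + 1) (int n) (int n))
                     (Q3w (n + 2) (int n + 1) (int n + 1) (int n - 1)) \<oplus>\<^sub>F U1_extra (Suc n)"
  proof -
    have "(\<lambda>p. (p$3 ^ n / (1 + p$3) ^ (n + 2)) *\<^sub>R
        vector [partial 1 r (xy p) * p$3, partial 2 r (xy p) * p$3, - r (xy p)]) \<in> U1_extra (Suc n)"
      unfolding U1_extra_def using r by auto
    then show ?thesis
      unfolding u_def
      by (intro sum_spaceI triple_spaceI Q3wI Q2_extend_affine A B space_zero) auto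
  qed
  moreover have "(\<lambda>q. vector [u (face_y d q) $ 1, u (face_y d q) $ 3]) \<in> U1_face (Suc n)"
    if "d \<in> {0, 1}" for d
  proof (cases "d = c")
    case True
    then show ?thesis using f face_c by simp
  next
    case False
    then have "a + b * d = 0"
      using ab(2) that by blast
    then have "(\<lambda>q. vector [u (face_y d q) $ 1, u (face_y d q) $ 3] :: real^2) = (\<lambda>q. vector [0, 0])"
      by (simp add: u_def partial_r r_def vec2_eq_iff fun_eq_iff)
    then show ?thesis by (simp only: zero_U1_face)
  qed
  moreover have "(\<lambda>q. vector [u (face_x d q) $ 2, u (face_x d q) $ 3]) \<in> U1_face (Suc n)" for d
  proof -
    define m where "m = e * d - s"
    \<comment> \<open>\<open>q$2 - (-1)\<close> is 1+z in the shape of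
      \<open>poly_sub_shift\<close>: the powers z^(n+1) and (1+z)^(n+1) cancel to degree n.
      \<open>G\<close> uses the same cancellation one degree lower, with a factor w.\<close>
    define F where "F q = (m * b) * (q$2 ^ Suc n - (q$2 - (-1)) ^ Suc n)" for q :: "real^2"
    define G where "G q = (a + b * q$1) * B (vector [d, q$2]) - (m * a) * (q$1 ^ 0 * q$2 ^ n) -
      (m * b) * (q$1 * (q$2 ^ n - (q$2 - (-1)) ^ n))" for q :: "real^2"
    have F: "F \<in> P2 (int n)"
      unfolding F_def by (intro poly_scale poly_sub_shift) simp
    have G: "G \<in> P2 (int n)"
      unfolding G_def
      by (intro poly_diff poly_scale Q2_restrict_affine[OF B] P2_monom
          P2_mult[OF P2_coord1[OF order.refl] poly_sub_shift(2)[OF order.refl]]) auto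
    have univ: "(\<Sum>i\<le>n. (if i = 0 then m * b else 0) * q$1 ^ i * (1 + q$2) ^ (n - i)) =
        m * b * (1 + q$2) ^ n" for q :: "real^2"
      by (subst sum.atMost_shift) simp
    have combine: "vector [v / D, w / D] = (vector [x / D, y / D] + (h / D) *\<^sub>R vector [s, - t] :: real^2)"
      if "x + h * s = v" "y - h * t = w" for x y v w h s t D :: real
      unfolding that[symmetric] by (simp add: vec2_eq_iff add_divide_distrib diff_divide_distrib)
    have "(\<lambda>q. vector [u (face_x d q) $ 2, u (face_x d q) $ 3]) =
        (\<lambda>q. vector [F q / (1 + q$2) ^ (n + 2), G q / (1 + q$2) ^ (n + 2)] +
        (m * b * (1 + q$2) ^ n / (1 + q$2) ^ (n + 2)) *\<^sub>R vector [1 + q$2, - q$1] :: real^2)"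
    proof
      fix q :: "real^2"
      have "F q + m * b * (1 + q$2) ^ n * (1 + q$2) = m * b * q$2 ^ n * q$2"
        by (simp add: F_def algebra_simps)
      moreover have "G q - m * b * (1 + q$2) ^ n * q$1 =
          (a + b * q$1) * B (vector [d, q$2]) - m * (a + b * q$1) * q$2 ^ n"
        by (simp add: G_def algebra_simps)
      moreover have "u (face_x d q) $ 2 = m * b * q$2 ^ n * q$2 / (1 + q$2) ^ (n + 2)"
        by (simp add: u_def partial_r m_def)
      moreover have "u (face_x d q) $ 3 =
          ((a + b * q$1) * B (vector [d, q$2]) - m * (a + b * q$1) * q$2 ^ n) / (1 + q$2) ^ (n + 2)"
        by (simp add: u_def r_def m_def diff_divide_distrib)
      ultimately show "vector [u (face_x d q) $ 2, u (face_x d q) $ 3] =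
          (vector [F q / (1 + q$2) ^ (n + 2), G q / (1 + q$2) ^ (n + 2)] +
          (m * b * (1 + q$2) ^ n / (1 + q$2) ^ (n + 2)) *\<^sub>R vector [1 + q$2, - q$1] :: real^2)"
        by (simp only:) (rule combine)
    qed
    then show ?thesis
      using U1_faceI[OF F G, of "\<lambda>i. if i = 0 then m * b else 0"] unfolding univ by (simp only:)
  qed
  ultimately have "u \<in> U1_inf (Suc n)"
    unfolding U1_inf_def by (simp add: agreeing_self add.commute)
  then show ?thesis using that face_c by blast
qed

text \<open>The extra field has second component 2 s z^n, hence the factor 1/2 in \<open>s\<close>.
  All first components are 0, which settles the faces x = 0, 1, and the third component, where s_y
  appears, is not constrained by any vertical face.\<close>

lemma U2_inf_extend:
  assumes f: "f \<in> P2w (n + 3) (int n)" and c: "c \<in> {0, 1}"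
  obtains u where "u \<in> U2_inf (Suc n)" "\<And>q. u (face_y c q) $ 2 = f q"
proof -
  obtain F where F: "F \<in> P2 (int n)" and f_eq: "f = (\<lambda>q. F q / (1 + q$2) ^ (n + 3))"
    using f unfolding P2w_def by blast
  obtain g e where g: "g \<in> Q2 (int n) (int n - 1)" and F_eq: "\<And>q. F q = g q + e * q$2 ^ n"
    using P2_split_top[OF F] by blast
  obtain a b where ab: "a + b * c = 1" "\<And>d. d \<in> {0, 1} \<Longrightarrow> d \<noteq> c \<Longrightarrow> a + b * d = 0"
    using affine_cutoff[OF c] by blast
  define s where "s q = e / 2 * (a + b * q$2)" for q :: "real^2"
  have s: "s \<in> Q2 (int n) (int n + 1)"
  proof -
    have "(\<lambda>q::real^2. (e / 2 * a) * (q$1 ^ 0 * q$2 ^ 0) + (e / 2 * b) * (q$1 ^ 0 * q$2 ^ 1))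
        \<in> Q2 (int n) (int n + 1)"
      by (intro poly_add poly_scale Q2_monom) auto
    then show ?thesis
      by (simp add: s_def[abs_def] algebra_simps)
  qed
  define u :: "real^3 \<Rightarrow> real^3" where "u p = vector [0, (a + b * p$2) * g (vector [p$1, p$3]) / (1 + p$3) ^ (n + 3), 0] +
      (p$3 ^ n / (1 + p$3) ^ (n + 3)) *\<^sub>R
        vector [0, 2 * s (xy p), partial 2 s (xy p) * (1 + p$3)] +
      (p$3 ^ n / (1 + p$3) ^ (n + 3)) *\<^sub>R
        vector [2 * 0, 0, partial 1 (\<lambda>q. 0) (xy p) * (1 + p$3)]" for p :: "real^3"
  have face_c: "u (face_y c q) $ 2 = f q" for q
    by (simp add: u_def s_def ab(1) f_eq F_eq add_divide_distrib)
  have "u \<in> triple_space (Q3w (n + 3) (int n + 1) (int n) (int n - 1))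
                     (Q3w (n + 3) (int n) (int n + 1) (int n - 1))
                     (Q3w (n + 3) (int n) (int n) (int n)) \<oplus>\<^sub>F
      U2_extra_s (Suc n) \<oplus>\<^sub>F U2_extra_t (Suc n)"
  proof -
    have "(\<lambda>p. (p$3 ^ n / (1 + p$3) ^ (n + 3)) *\<^sub>R
        vector [0, 2 * s (xy p), partial 2 s (xy p) * (1 + p$3)]) \<in> U2_extra_s (Suc n)"
      unfolding U2_extra_s_def using s
      by (intro CollectI exI[of _ s]) (simp add: add.commute eval_nat_numeral)
    moreover have "(\<lambda>p. (p$3 ^ n / (1 + p$3) ^ (n + 3)) *\<^sub>R
        vector [2 * 0, 0, partial 1 (\<lambda>q. 0) (xy p) * (1 + p$3)]) \<in> U2_extra_t (Suc n)"
      unfolding U2_extra_t_def by (intro CollectI exI[of _ "\<lambda>q. 0"]) (simp add: eval_nat_numeral)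
    ultimately show ?thesis
      unfolding u_def
      by (intro sum_spaceI triple_spaceI Q3wI Q2_extend_affine g space_zero) auto
  qed
  moreover have "(\<lambda>q. u (face_y d q) $ 2) \<in> P2w (n + 3) (int n)" if "d \<in> {0, 1}" for d
  proof (cases "d = c")
    case True
    then show ?thesis using f face_c by simp
  next
    case False
    then have "(\<lambda>q. u (face_y d q) $ 2) = (\<lambda>q. 0)"
      using ab(2) that by (simp add: u_def s_def)
    then show ?thesis by simp
  qed
  moreover have "(\<lambda>q. u (face_x d q) $ 1) \<in> P2w (n + 3) (int n)" for d
  proof -
    have "(\<lambda>q. u (face_x d q) $ 1) = (\<lambda>q. 0)"
      by (simp add: u_def)
    then show ?thesis by simp
  qed
  ultimately have "u \<in> U2_inf (Suc n)"
    unfolding U2_inf_def by (simp add: agreeing_self add.commute eval_nat_numeral)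
  then show ?thesis using that face_c by blast
qed

subsection \<open>Traces on the base\<close>

lemma Q3w_restrict_base:
  assumes "f \<in> Q3w k l m n"
  shows "(\<lambda>q. f (vector [q$1, q$2, 0])) \<in> Q2 l m"
proof -
  obtain g where "g \<in> Q3 l m n" and f: "f = (\<lambda>p. g p / (1 + p$3) ^ k)"
    using assms unfolding Q3w_def by blast
  from this(1) have "(\<lambda>q. g (vector [q$1, q$2, 0])) \<in> Q2 l m"
  proof (induction rule: Q3_induct)
    case (monom a h i j)
    have "(\<lambda>q. (a * 0 ^ j) * (q$1 ^ h * q$2 ^ i)) \<in> Q2 l m"
      using monom by (intro poly_scale Q2_monom) auto
    then show ?case by (simp add: mult_ac)
  qed (auto intro: poly_add)
  then show ?thesis by (simp add: f)
qed

lemma Q2_extend_const: "g \<in> Q2 l m \<Longrightarrow> 0 \<le> n \<Longrightarrow> (\<lambda>p. g (xy p)) \<in> Q3 l m n"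
proof (induction rule: Q2_induct)
  case (monom a i j)
  then show ?case
    using poly_scale(3)[OF Q3_monom[of i l j m 0 n], of a] by (simp add: xy_def)
qed (auto intro: poly_add)

text \<open>Fixing one variable leaves a polynomial in w alone. A bidegree (k, k), whose total
  degree may be 2k, therefore still satisfies the total-degree conditions on the vertical
  faces.\<close>

lemma Q2_restrict_line:
  assumes "g \<in> Q2 l m"
  shows "l \<le> d \<Longrightarrow> (\<lambda>q. g (vector [q$1, c])) \<in> P2 d"
    and "m \<le> d \<Longrightarrow> (\<lambda>q. g (vector [c, q$1])) \<in> P2 d"
proof -
  have "(l \<le> d \<longrightarrow> (\<lambda>q. g (vector [q$1, c])) \<in> P2 d) \<and> (m \<le> d \<longrightarrow> (\<lambda>q. g (vector [c, q$1])) \<in> P2 d)"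
    using assms
  proof (induction rule: Q2_induct)
    case (monom a i j)
    then show ?case
      using poly_scale(1)[OF P2_monom[of i 0 d], of "a * c ^ j"]
        poly_scale(1)[OF P2_monom[of j 0 d], of "a * c ^ i"]
      by (simp add: mult_ac)
  qed (auto intro: poly_add)
  then show "l \<le> d \<Longrightarrow> (\<lambda>q. g (vector [q$1, c])) \<in> P2 d" "m \<le> d \<Longrightarrow> (\<lambda>q. g (vector [c, q$1])) \<in> P2 d"
    by blast+
qed

lemma inf_chart_Base_in_Omega_inf: "q \<in> face_dom Base \<Longrightarrow> inf_chart Base q \<in> Omega_inf"
  unfolding face_dom_Base by (auto simp: Omega_inf_def)

text \<open>The extra function z^k/(1+z)^k vanishes at z = 0 because k is positive.\<close>

lemma U0_inf_base:
  assumes "u \<in> U0_inf k" "k \<ge> 1"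
  obtains g where "g \<in> Q2 (int k) (int k)" "\<And>q. q \<in> face_dom Base \<Longrightarrow> u (inf_chart Base q) = g q"
proof -
  obtain f c where f: "f \<in> Q3w k (int k) (int k) (int k - 1)"
    and u: "\<And>p. p \<in> Omega_inf \<Longrightarrow> u p = f p + c * (p$3 ^ k / (1 + p$3) ^ k)"
    using assms(1) unfolding U0_inf_def agreeing_def sum_space_def by auto
  have "u (inf_chart Base q) = f (vector [q$1, q$2, 0])" if "q \<in> face_dom Base" for q
    using u[OF inf_chart_Base_in_Omega_inf[OF that]] assms(2) by simp
  with Q3w_restrict_base[OF f] show ?thesis
    by (rule that)
qed

lemma U0_inf_base_extend:
  assumes "g \<in> Q2 (int k) (int k)" "k \<ge> 1"
  obtains u where "u \<in> U0_inf k" "\<And>q. u (inf_chart Base q) = g q"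
proof -
  define u where "u p = g (xy p) / (1 + p$3) ^ k + 0 * (p$3 ^ k / (1 + p$3) ^ k)" for p :: "real^3"
  have zero: "(\<lambda>p::real^3. 0 * (p$3 ^ k / (1 + p$3) ^ k)) \<in> {\<lambda>p. c * (p$3 ^ k / (1 + p$3) ^ k) | c. True}"
    by blast
  have "u \<in> Q3w k (int k) (int k) (int k - 1) \<oplus>\<^sub>F {\<lambda>p. c * (p$3 ^ k / (1 + p$3) ^ k) | c. True}"
    unfolding u_def using assms(2) by (intro sum_spaceI zero Q3wI Q2_extend_const[OF assms(1)]) auto
  moreover have "(\<lambda>q. u (face_y c q)) \<in> P2w k (int k)" for c
    using P2wI[OF Q2_restrict_line(1)[OF assms(1) order.refl, of c], of k] by (simp add: u_def)
  moreover have "(\<lambda>q. u (face_x c q)) \<in> P2w k (int k)" for c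
    using P2wI[OF Q2_restrict_line(2)[OF assms(1) order.refl, of c], of k] by (simp add: u_def)
  ultimately have "u \<in> U0_inf k"
    unfolding U0_inf_def by (simp add: agreeing_self)
  moreover have "u (inf_chart Base q) = g q" for q
    by (simp add: u_def xy_def)
  ultimately show ?thesis using that by blast
qed

text \<open>The horizontal components of the extra field carry the factor z^(n+1), so they vanish on
  the base even for n = 0; the component without the additional z is not tangential there.\<close>

lemma U1_inf_base:
  assumes "u \<in> U1_inf (Suc n)"
  obtains g where "g \<in> sigma1 (Suc n)"
    "\<And>q. q \<in> face_dom Base \<Longrightarrow> vector [u (inf_chart Base q) $ 1, u (inf_chart Base q) $ 2] = g q"
proof -
  obtain f1 f2 f3 r where f: "f1 \<in> Q3w (n + 2) (int n) (int n + 1) (int n)"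
        "f2 \<in> Q3w (n + 2) (int n + 1) (int n) (int n)"
    and u: "\<And>p. p \<in> Omega_inf \<Longrightarrow> u p = vector [f1 p, f2 p, f3 p] + (p$3 ^ n / (1 + p$3) ^ (n + 2)) *\<^sub>R
        vector [partial 1 r (xy p) * p$3, partial 2 r (xy p) * p$3, - r (xy p)]"
    using assms unfolding U1_inf_def agreeing_def sum_space_def triple_space_def U1_extra_def
    by (auto simp: add.commute)
  have "(\<lambda>q. vector [f1 (vector [q$1, q$2, 0]), f2 (vector [q$1, q$2, 0])]) \<in> sigma1 (Suc n)"
    unfolding sigma1_def
    using Q3w_restrict_base[OF f(1)] Q3w_restrict_base[OF f(2)] by (intro pair_spaceI) (auto simp: add.commute)
  moreover have "vector [u (inf_chart Base q) $ 1, u (inf_chart Base q) $ 2] =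
      vector [f1 (vector [q$1, q$2, 0]), f2 (vector [q$1, q$2, 0])]" if "q \<in> face_dom Base" for q
    using u[OF inf_chart_Base_in_Omega_inf[OF that]] by (simp add: vec2_eq_iff)
  ultimately show ?thesis
    by (rule that)
qed

text \<open>With third component 0, the face y = c sees only (g1(w, c), 0)/(1+z)^(n+2), and
  \<open>g1\<close> has degree at most n in its first variable; x = c is alike with
  \<open>g2\<close> and its second variable.\<close>

lemma U1_inf_base_extend:
  assumes "g \<in> sigma1 (Suc n)"
  obtains u where "u \<in> U1_inf (Suc n)"
    "\<And>q. vector [u (inf_chart Base q) $ 1, u (inf_chart Base q) $ 2] = g q"
proof -
  obtain g1 g2 where g12: "g1 \<in> Q2 (int n) (int n + 1)" "g2 \<in> Q2 (int n + 1) (int n)"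
    and g: "g = (\<lambda>q. vector [g1 q, g2 q])"
    using assms unfolding sigma1_def pair_space_def by (auto simp: add.commute)
  define u :: "real^3 \<Rightarrow> real^3" where
    "u p = vector [g1 (xy p) / (1 + p$3) ^ (n + 2), g2 (xy p) / (1 + p$3) ^ (n + 2), 0] +
      (p$3 ^ n / (1 + p$3) ^ (n + 2)) *\<^sub>R
        vector [partial 1 (\<lambda>q. 0) (xy p) * p$3, partial 2 (\<lambda>q. 0) (xy p) * p$3, - 0]" for p
  have partial_0: "partial i (\<lambda>q. 0) q = 0" for i q
    by (simp add: partial_eqI[OF has_derivative_const])
  have face_vec: "(\<lambda>q. vector [f q / (1 + q$2) ^ (n + 2), 0]) \<in> U1_face (Suc n)"
    if "f \<in> P2 (int n)" for f
    using U1_faceI[OF that, of "\<lambda>q. 0" "\<lambda>a. 0"] by simp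
  have "u \<in> triple_space (Q3w (n + 2) (int n) (int n + 1) (int n))
                     (Q3w (n + 2) (int n + 1) (int n) (int n))
                     (Q3w (n + 2) (int n + 1) (int n + 1) (int n - 1)) \<oplus>\<^sub>F U1_extra (Suc n)"
  proof -
    have "(\<lambda>p. (p$3 ^ n / (1 + p$3) ^ (n + 2)) *\<^sub>R
        vector [partial 1 (\<lambda>q. 0) (xy p) * p$3, partial 2 (\<lambda>q. 0) (xy p) * p$3, - 0]) \<in> U1_extra (Suc n)"
      unfolding U1_extra_def by (intro CollectI exI[of _ "\<lambda>q. 0"]) simp
    then show ?thesis
      unfolding u_def
      by (intro sum_spaceI triple_spaceI Q3wI Q2_extend_const g12 space_zero) auto
  qed
  moreover have "(\<lambda>q. vector [u (face_y c q) $ 1, u (face_y c q) $ 3]) \<in> U1_face (Suc n)" for c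
    using face_vec[OF Q2_restrict_line(1)[OF g12(1) order.refl, of c]] by (simp add: u_def partial_0)
  moreover have "(\<lambda>q. vector [u (face_x c q) $ 2, u (face_x c q) $ 3]) \<in> U1_face (Suc n)" for c
    using face_vec[OF Q2_restrict_line(2)[OF g12(2) order.refl, of c]] by (simp add: u_def partial_0)
  ultimately have "u \<in> U1_inf (Suc n)"
    unfolding U1_inf_def by (simp add: agreeing_self add.commute)
  moreover have "vector [u (inf_chart Base q) $ 1, u (inf_chart Base q) $ 2] = g q" for q
    by (simp add: u_def xy_def g partial_0)
  ultimately show ?thesis using that by blast
qed

lemma U2_inf_base:
  assumes "u \<in> U2_inf (Suc n)"
  obtains g where "g \<in> Q2 (int n) (int n)"
    "\<And>q. q \<in> face_dom Base \<Longrightarrow> u (inf_chart Base q) $ 3 = g q"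
proof -
  obtain f1 f2 f3 s t where f: "f3 \<in> Q3w (n + 3) (int n) (int n) (int n)"
    and st: "s \<in> Q2 (int n) (int n + 1)" "t \<in> Q2 (int n + 1) (int n)"
    and u: "\<And>p. p \<in> Omega_inf \<Longrightarrow> u p = vector [f1 p, f2 p, f3 p] + (p$3 ^ n / (1 + p$3) ^ (n + 3)) *\<^sub>R
          vector [0, 2 * s (xy p), partial 2 s (xy p) * (1 + p$3)] +
          (p$3 ^ n / (1 + p$3) ^ (n + 3)) *\<^sub>R
          vector [2 * t (xy p), 0, partial 1 t (xy p) * (1 + p$3)]"
    using assms
    unfolding U2_inf_def agreeing_def sum_space_def triple_space_def U2_extra_s_def U2_extra_t_def
    by (auto simp: add.commute eval_nat_numeral)
  \<comment> \<open>For n = 0 the factor z^n is 1 and the extra fields do reach the base. Their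
    contributions s_y and t_x have lost the degree by which s and t exceeded n.\<close>
  have "(\<lambda>q. f3 (vector [q$1, q$2, 0]) + 0 ^ n * (partial 2 s q + partial 1 t q)) \<in> Q2 (int n) (int n)"
    using Q2_partial(3)[OF st(1)] Q2_partial(2)[OF st(2)]
    by (intro poly_add poly_scale Q3w_restrict_base[OF f]) auto
  moreover have "u (inf_chart Base q) $ 3 = f3 (vector [q$1, q$2, 0]) + 0 ^ n * (partial 2 s q + partial 1 t q)"
    if "q \<in> face_dom Base" for q
    using u[OF inf_chart_Base_in_Omega_inf[OF that]] by (simp add: xy_def algebra_simps)
  ultimately show ?thesis
    by (rule that)
qed

lemma U2_inf_base_extend:
  assumes g: "g \<in> Q2 (int n) (int n)"
  obtains u where "u \<in> U2_inf (Suc n)" "\<And>q. u (inf_chart Base q) $ 3 = g q"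
proof -
  define u :: "real^3 \<Rightarrow> real^3" where "u p = vector [0, 0, g (xy p) / (1 + p$3) ^ (n + 3)] +
      (p$3 ^ n / (1 + p$3) ^ (n + 3)) *\<^sub>R
        vector [0, 2 * 0, partial 2 (\<lambda>q. 0) (xy p) * (1 + p$3)] +
      (p$3 ^ n / (1 + p$3) ^ (n + 3)) *\<^sub>R
        vector [2 * 0, 0, partial 1 (\<lambda>q. 0) (xy p) * (1 + p$3)]" for p
  have partial_0: "partial i (\<lambda>q. 0) q = 0" for i q
    by (simp add: partial_eqI[OF has_derivative_const])
  have "u \<in> triple_space (Q3w (n + 3) (int n + 1) (int n) (int n - 1))
                     (Q3w (n + 3) (int n) (int n + 1) (int n - 1))
                     (Q3w (n + 3) (int n) (int n) (int n)) \<oplus>\<^sub>F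
      U2_extra_s (Suc n) \<oplus>\<^sub>F U2_extra_t (Suc n)"
  proof -
    have "(\<lambda>p. (p$3 ^ n / (1 + p$3) ^ (n + 3)) *\<^sub>R
        vector [0, 2 * 0, partial 2 (\<lambda>q. 0) (xy p) * (1 + p$3)]) \<in> U2_extra_s (Suc n)"
      unfolding U2_extra_s_def by (intro CollectI exI[of _ "\<lambda>q. 0"]) (simp add: eval_nat_numeral)
    moreover have "(\<lambda>p. (p$3 ^ n / (1 + p$3) ^ (n + 3)) *\<^sub>R
        vector [2 * 0, 0, partial 1 (\<lambda>q. 0) (xy p) * (1 + p$3)]) \<in> U2_extra_t (Suc n)"
      unfolding U2_extra_t_def by (intro CollectI exI[of _ "\<lambda>q. 0"]) (simp add: eval_nat_numeral)
    ultimately show ?thesis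
      unfolding u_def
      by (intro sum_spaceI triple_spaceI Q3wI Q2_extend_const g space_zero) auto
  qed
  moreover have "(\<lambda>q. u (face_y d q) $ 2) = (\<lambda>q. 0)" "(\<lambda>q. u (face_x d q) $ 1) = (\<lambda>q. 0)" for d
    by (simp_all add: u_def)
  ultimately have "u \<in> U2_inf (Suc n)"
    unfolding U2_inf_def by (simp add: agreeing_self add.commute eval_nat_numeral)
  moreover have "u (inf_chart Base q) $ 3 = g q" for q
    by (simp add: u_def xy_def partial_0)
  ultimately show ?thesis using that by blast
qed

subsection \<open>Transport to the finite pyramid\<close>

text \<open>As 1 - \<zeta> = 1/(1+z), dividing by 1 - \<zeta> undoes \<open>phi\<close>. Composition
  with this map yields the preimages under the pullbacks.\<close>

lemma phi_inverse:
  assumes "p$3 \<noteq> -1"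
  shows "(1 / (1 - phi p$3)) *\<^sub>R phi p = p"
proof -
  have nz: "1 + p$3 \<noteq> 0"
    using assms by (simp add: add_eq_0_iff)
  then have "1 - phi p$3 = 1 / (1 + p$3)"
    by (simp add: phi_def field_simps)
  then show ?thesis
    using nz by (simp add: vec3_eq_iff) (simp add: phi_def)
qed

lemma Omega_inf_3: "p \<in> Omega_inf \<Longrightarrow> p$3 \<noteq> -1"
  by (auto simp: Omega_inf_def)

lemma pullback0_surj: "\<exists>u. \<forall>p\<in>Omega_inf. pullback0 u p = w p"
  by (intro exI[of _ "\<lambda>p. w ((1 / (1 - p$3)) *\<^sub>R p)"])
    (auto simp: pullback0_def phi_inverse Omega_inf_3)

text \<open>\<open>G\<close> is the solution of the triangular system in
  \<open>pullback1_eq\<close>, written in the coordinates of the infinite pyramid.\<close>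

lemma pullback1_surj: "\<exists>E. \<forall>p\<in>Omega_inf. pullback1 E p = w p"
proof -
  define G :: "real^3 \<Rightarrow> real^3" where
    "G p = vector [(1 + p$3) * w p$1, (1 + p$3) * w p$2,
      (1 + p$3)\<^sup>2 * w p$3 + (1 + p$3) * (p$1 * w p$1 + p$2 * w p$2)]" for p
  have "pullback1 (\<lambda>p. G ((1 / (1 - p$3)) *\<^sub>R p)) p = w p" if "p \<in> Omega_inf" for p
  proof -
    have p3: "p$3 \<noteq> -1"
      using that by (rule Omega_inf_3)
    then have "1 + p$3 \<noteq> 0"
      by (simp add: add_eq_0_iff)
    then show ?thesis
      unfolding pullback1_eq[OF p3] phi_inverse[OF p3]
      by (simp add: G_def vec3_eq_iff) (simp add: algebra_simps)
  qed
  then show ?thesis by blast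
qed

lemma pullback2_surj: "\<exists>v. \<forall>p\<in>Omega_inf. pullback2 v p = w p"
proof -
  define G :: "real^3 \<Rightarrow> real^3" where
    "G p = vector [(1 + p$3) ^ 3 * w p$1 - p$1 * ((1 + p$3)\<^sup>2 * w p$3),
      (1 + p$3) ^ 3 * w p$2 - p$2 * ((1 + p$3)\<^sup>2 * w p$3), (1 + p$3)\<^sup>2 * w p$3]" for p
  have "pullback2 (\<lambda>p. G ((1 / (1 - p$3)) *\<^sub>R p)) p = w p" if "p \<in> Omega_inf" for p
  proof -
    have p3: "p$3 \<noteq> -1"
      using that by (rule Omega_inf_3)
    then have "1 + p$3 \<noteq> 0"
      by (simp add: add_eq_0_iff)
    then show ?thesis
      unfolding pullback2_eq[OF p3] phi_inverse[OF p3]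
      by (simp add: G_def vec3_eq_iff)
  qed
  then show ?thesis by blast
qed

lemma agreeing_cong:
  assumes "\<And>p. p \<in> D \<Longrightarrow> f p = g p"
  shows "f \<in> agreeing D A \<longleftrightarrow> g \<in> agreeing D A"
  using assms unfolding agreeing_def by auto

lemma inf_chart_in_Omega_inf:
  "c \<in> {0, 1} \<Longrightarrow> q \<in> inf_face \<Longrightarrow> face_x c q \<in> Omega_inf"
  "c \<in> {0, 1} \<Longrightarrow> q \<in> inf_face \<Longrightarrow> face_y c q \<in> Omega_inf"
  by (auto simp: Omega_inf_def inf_face_def)

text \<open>Preimages under the pullback are controlled on \<open>Omega_inf\<close> only; this is
  enough because every condition is stated by \<open>agreeing\<close> on that set or on its
  faces.\<close>

lemma U0_inf_cong:
  assumes uv: "\<And>p. p \<in> Omega_inf \<Longrightarrow> u p = v p" and "v \<in> U0_inf k"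
  shows "u \<in> U0_inf k"
proof -
  have "u \<in> agreeing Omega_inf A \<longleftrightarrow> v \<in> agreeing Omega_inf A" for A
    by (rule agreeing_cong) (rule uv)
  moreover have "(\<lambda>q. u (face_y c q)) \<in> agreeing inf_face A \<longleftrightarrow> (\<lambda>q. v (face_y c q)) \<in> agreeing inf_face A"
    "(\<lambda>q. u (face_x c q)) \<in> agreeing inf_face A \<longleftrightarrow> (\<lambda>q. v (face_x c q)) \<in> agreeing inf_face A"
    if "c \<in> {0, 1}" for A c
    by (rule agreeing_cong, simp add: uv inf_chart_in_Omega_inf[OF that])+
  ultimately show ?thesis
    using assms(2) unfolding U0_inf_def by blast
qed

lemma U1_inf_cong:
  assumes uv: "\<And>p. p \<in> Omega_inf \<Longrightarrow> u p = v p" and "v \<in> U1_inf k"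
  shows "u \<in> U1_inf k"
proof -
  have "u \<in> agreeing Omega_inf A \<longleftrightarrow> v \<in> agreeing Omega_inf A" for A
    by (rule agreeing_cong) (rule uv)
  moreover have "(\<lambda>q. vector [u (face_y c q) $ 1, u (face_y c q) $ 3]) \<in> agreeing inf_face (U1_face k) \<longleftrightarrow>
      (\<lambda>q. vector [v (face_y c q) $ 1, v (face_y c q) $ 3]) \<in> agreeing inf_face (U1_face k)"
    "(\<lambda>q. vector [u (face_x c q) $ 2, u (face_x c q) $ 3]) \<in> agreeing inf_face (U1_face k) \<longleftrightarrow>
      (\<lambda>q. vector [v (face_x c q) $ 2, v (face_x c q) $ 3]) \<in> agreeing inf_face (U1_face k)"
    if "c \<in> {0, 1}" for c
    by (rule agreeing_cong, simp add: uv inf_chart_in_Omega_inf[OF that])+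
  ultimately show ?thesis
    using assms(2) unfolding U1_inf_def by blast
qed

lemma U2_inf_cong:
  assumes uv: "\<And>p. p \<in> Omega_inf \<Longrightarrow> u p = v p" and "v \<in> U2_inf k"
  shows "u \<in> U2_inf k"
proof -
  have "u \<in> agreeing Omega_inf A \<longleftrightarrow> v \<in> agreeing Omega_inf A" for A
    by (rule agreeing_cong) (rule uv)
  moreover have "(\<lambda>q. u (face_y c q) $ 2) \<in> agreeing inf_face A \<longleftrightarrow>
      (\<lambda>q. v (face_y c q) $ 2) \<in> agreeing inf_face A"
    "(\<lambda>q. u (face_x c q) $ 1) \<in> agreeing inf_face A \<longleftrightarrow>
      (\<lambda>q. v (face_x c q) $ 1) \<in> agreeing inf_face A"
    if "c \<in> {0, 1}" for A c
    by (rule agreeing_cong, simp add: uv inf_chart_in_Omega_inf[OF that])+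
  ultimately show ?thesis
    using assms(2) unfolding U2_inf_def by blast
qed

lemma U0_of_inf:
  assumes "w \<in> U0_inf k"
  obtains u where "u \<in> U0 k" "\<And>p. p \<in> Omega_inf \<Longrightarrow> pullback0 u p = w p"
proof -
  obtain u where u: "\<forall>p\<in>Omega_inf. pullback0 u p = w p"
    using pullback0_surj by blast
  have "pullback0 u \<in> U0_inf k"
    by (rule U0_inf_cong[OF _ assms]) (use u in blast)
  then have "u \<in> U0 k"
    by (simp add: U0_def)
  with u show ?thesis
    by (intro that[of u]) auto
qed

lemma U1_of_inf:
  assumes "w \<in> U1_inf k"
  obtains u where "u \<in> U1 k" "\<And>p. p \<in> Omega_inf \<Longrightarrow> pullback1 u p = w p"
proof -
  obtain u where u: "\<forall>p\<in>Omega_inf. pullback1 u p = w p"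
    using pullback1_surj by blast
  have "pullback1 u \<in> U1_inf k"
    by (rule U1_inf_cong[OF _ assms]) (use u in blast)
  then have "u \<in> U1 k"
    by (simp add: U1_def)
  with u show ?thesis
    by (intro that[of u]) auto
qed

lemma U2_of_inf:
  assumes "w \<in> U2_inf k"
  obtains u where "u \<in> U2 k" "\<And>p. p \<in> Omega_inf \<Longrightarrow> pullback2 u p = w p"
proof -
  obtain u where u: "\<forall>p\<in>Omega_inf. pullback2 u p = w p"
    using pullback2_surj by blast
  have "pullback2 u \<in> U2_inf k"
    by (rule U2_inf_cong[OF _ assms]) (use u in blast)
  then have "u \<in> U2 k"
    by (simp add: U2_def)
  with u show ?thesis
    by (intro that[of u]) auto
qed

text \<open>
  The orientation of the charts of \<open>S1\<close> and \<open>S3\<close> accounts for the sign of the normal component.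
\<close>

fun inf_tangent :: "face \<Rightarrow> real^3 \<Rightarrow> real^2" where
  "inf_tangent S1 w = vector [w$1, w$3]"
| "inf_tangent S2 w = vector [w$2, w$3]"
| "inf_tangent S3 w = vector [w$1, w$3]"
| "inf_tangent S4 w = vector [w$2, w$3]"
| "inf_tangent Base w = vector [w$1, w$2]"

fun inf_normal :: "face \<Rightarrow> real^3 \<Rightarrow> real" where
  "inf_normal S1 w = - w$2"
| "inf_normal S2 w = w$1"
| "inf_normal S3 w = - w$2"
| "inf_normal S4 w = w$1"
| "inf_normal Base w = w$3"

section \<open>Traces as pullbacks from the infinite pyramid\<close>

lemma inf_chart_vertical:
  assumes "F \<in> {S1, S2, S3, S4}" "q \<in> inf_face"
  shows "inf_chart F q \<in> Omega_inf" "inf_chart F q $ 3 \<noteq> -1" "phi2 q \<in> face_dom F"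
  using assms phi2_in_fin_face[OF assms(2)] face_dom_vertical[OF assms(1)]
  by (auto simp: inf_chart_in_Omega_inf) (auto simp: inf_face_def)

lemma trace0_phi2:
  assumes "F \<in> {S1, S2, S3, S4}" "q \<in> inf_face"
  shows "trace0 F u (phi2 q) = pullback0 u (inf_chart F q)"
  using assms inf_chart_vertical(3)[OF assms]
  by (simp add: trace0_def pullback0_def chart_phi2 del: chart.simps)

text \<open>In the third component of the pullback, the field component across the face is
  multiplied by c in {0, 1}. For c = 1 this supplies the term subtracted by the slanted chart, for c
  = 0 it drops out; one formula thus serves all four faces.\<close>

lemma trace1_phi2:
  assumes F: "F \<in> {S1, S2, S3, S4}" and q: "q \<in> inf_face"
  shows "inf_tangent F (pullback1 E (inf_chart F q)) = vector [trace1 F E (phi2 q) $ 1 / (1 + q$2),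
    (trace1 F E (phi2 q) $ 2 - q$1 * trace1 F E (phi2 q) $ 1) / (1 + q$2)\<^sup>2]"
proof -
  have nz: "1 + q$2 \<noteq> 0"
    using q by (auto simp: inf_face_def)
  show ?thesis
    unfolding pullback1_eq[OF inf_chart_vertical(2)[OF F q]]
    using F nz trace1_eq[OF inf_chart_vertical(3)[OF F q], of E]
    unfolding chart_phi2[OF F q]
    by (auto simp: vec2_eq_iff algebra_simps)
qed

text \<open>The factor (1+z)^(-3) is the Jacobian determinant of \<open>phi2\<close>. The
  position-dependent term in \<open>pullback2_eq\<close> becomes the additional normal component of
  the slanted faces.\<close>

lemma trace2_phi2:
  assumes F: "F \<in> {S1, S2, S3, S4}" and q: "q \<in> inf_face"
  shows "inf_normal F (pullback2 v (inf_chart F q)) = trace2 F v (phi2 q) / (1 + q$2) ^ 3"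
  unfolding pullback2_eq[OF inf_chart_vertical(2)[OF F q]]
  using F trace2_eq[OF inf_chart_vertical(3)[OF F q], of v]
  unfolding chart_phi2[OF F q]
  by (auto simp: add_divide_distrib diff_divide_distrib)

text \<open>At z = 0 the Jacobian of \<open>phi\<close> is not the identity, as its last column is
  (-x, -y, 1), but tangential components of 1-forms and the normal component of 2-forms are not
  affected.\<close>

lemma trace_Base:
  assumes q: "q \<in> face_dom Base"
  shows "trace0 Base u q = pullback0 u (inf_chart Base q)"
    and "trace1 Base E q = inf_tangent Base (pullback1 E (inf_chart Base q))"
    and "trace2 Base v q = inf_normal Base (pullback2 v (inf_chart Base q))"
proof -
  have chart: "phi (inf_chart Base q) = chart Base q"
    by (simp add: phi_def vec3_eq_iff)
  have 3: "inf_chart Base q $ 3 \<noteq> -1"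
    by simp
  show "trace0 Base u q = pullback0 u (inf_chart Base q)"
    using q by (simp add: trace0_def pullback0_def chart del: chart.simps inf_chart.simps)
  show "trace1 Base E q = inf_tangent Base (pullback1 E (inf_chart Base q))"
    unfolding pullback1_eq[OF 3] trace1_eq(5)[OF q refl] chart by simp
  show "trace2 Base v q = inf_normal Base (pullback2 v (inf_chart Base q))"
    unfolding pullback2_eq[OF 3] trace2_eq(5)[OF q refl] chart by simp
qed

lemma U_inf_faces:
  assumes "F \<in> {S1, S2, S3, S4}"
  shows "u \<in> U0_inf k \<Longrightarrow> (\<lambda>q. u (inf_chart F q)) \<in> agreeing inf_face (P2w k (int k))"
    and "E \<in> U1_inf k \<Longrightarrow> (\<lambda>q. inf_tangent F (E (inf_chart F q))) \<in> agreeing inf_face (U1_face k)"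
    and "v \<in> U2_inf k \<Longrightarrow> (\<lambda>q. inf_normal F (v (inf_chart F q))) \<in> agreeing inf_face (P2w (k + 2) (int k - 1))"
proof -
  have minus: "(\<lambda>q. - f q) \<in> agreeing inf_face (P2w m n)" if f: "f \<in> agreeing inf_face (P2w m n)" for f m n
  proof -
    obtain g where g: "g \<in> P2 n" "\<And>q. q \<in> inf_face \<Longrightarrow> f q = g q / (1 + q$2) ^ m"
      using f unfolding agreeing_def P2w_def by auto
    show ?thesis
      by (rule agreeingI[OF P2wI[OF poly_minus(1)[OF g(1)], of m]]) (simp add: g(2))
  qed
  show "u \<in> U0_inf k \<Longrightarrow> (\<lambda>q. u (inf_chart F q)) \<in> agreeing inf_face (P2w k (int k))"
    using assms unfolding U0_inf_def by auto
  show "E \<in> U1_inf k \<Longrightarrow> (\<lambda>q. inf_tangent F (E (inf_chart F q))) \<in> agreeing inf_face (U1_face k)"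
    using assms unfolding U1_inf_def by auto
  show "v \<in> U2_inf k \<Longrightarrow> (\<lambda>q. inf_normal F (v (inf_chart F q))) \<in> agreeing inf_face (P2w (k + 2) (int k - 1))"
    using assms unfolding U2_inf_def by (auto intro: minus)
qed

lemma vertical_face_cases:
  assumes "F \<in> {S1, S2, S3, S4}"
  obtains c where "c \<in> {0, 1}" "inf_chart F = face_y c" "inf_tangent F = (\<lambda>w. vector [w$1, w$3])"
      "inf_normal F = (\<lambda>w. - w$2)"
  | c where "c \<in> {0, 1}" "inf_chart F = face_x c" "inf_tangent F = (\<lambda>w. vector [w$2, w$3])"
      "inf_normal F = (\<lambda>w. w$1)"
proof -
  consider "F = S1" | "F = S2" | "F = S3" | "F = S4"
    using assms by blast
  then show ?thesis
  proof cases
    case 1 then show ?thesis by (intro that(1)[of 0]) auto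
  next
    case 2 then show ?thesis by (intro that(2)[of 1]) auto
  next
    case 3 then show ?thesis by (intro that(1)[of 1]) auto
  next
    case 4 then show ?thesis by (intro that(2)[of 0]) auto
  qed
qed

lemma U0_inf_surj_face:
  assumes F: "F \<in> {S1, S2, S3, S4}" and "f \<in> P2w k (int k)" "k \<ge> 1"
  obtains u where "u \<in> U0_inf k" "\<And>q. u (inf_chart F q) = f q"
  using F
proof (cases rule: vertical_face_cases)
  case (1 c)
  then show ?thesis
    using U0_inf_extend[OF assms(2,3), of c] that by metis
next
  case (2 c)
  obtain u where "u \<in> U0_inf k" "\<And>q. u (face_y c q) = f q"
    using U0_inf_extend[OF assms(2,3), of c] 2 by metis
  then show ?thesis
    using 2 by (intro that[of "\<lambda>p. u (swap3 p)"] U0_inf_swap) auto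
qed

lemma U1_inf_surj_face:
  assumes F: "F \<in> {S1, S2, S3, S4}" and "f \<in> U1_face (Suc n)"
  obtains u where "u \<in> U1_inf (Suc n)" "\<And>q. inf_tangent F (u (inf_chart F q)) = f q"
  using F
proof (cases rule: vertical_face_cases)
  case (1 c)
  then show ?thesis
    using U1_inf_extend[OF assms(2), of c] that by metis
next
  case (2 c)
  obtain u where "u \<in> U1_inf (Suc n)" "\<And>q. vector [u (face_y c q) $ 1, u (face_y c q) $ 3] = f q"
    using U1_inf_extend[OF assms(2), of c] 2 by metis
  then show ?thesis
    using 2 by (intro that[of "\<lambda>p. swap3 (u (swap3 p))"] U1_inf_swap) auto
qed

lemma U2_inf_surj_face:
  assumes F: "F \<in> {S1, S2, S3, S4}" and f: "f \<in> P2w (n + 3) (int n)"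
  obtains u where "u \<in> U2_inf (Suc n)" "\<And>q. inf_normal F (u (inf_chart F q)) = f q"
  using F
proof (cases rule: vertical_face_cases)
  case (1 c)
  obtain g where g: "g \<in> P2 (int n)" "f = (\<lambda>q. g q / (1 + q$2) ^ (n + 3))"
    using f unfolding P2w_def by blast
  have "(\<lambda>q. - f q) \<in> P2w (n + 3) (int n)"
    using P2wI[OF poly_minus(1)[OF g(1)], of "n + 3"] by (simp add: g(2))
  then obtain u where "u \<in> U2_inf (Suc n)" "\<And>q. u (face_y c q) $ 2 = - f q"
    using U2_inf_extend[of "\<lambda>q. - f q" n c] 1 by metis
  then show ?thesis
    using 1 by (intro that[of u]) auto
next
  case (2 c)
  obtain u where "u \<in> U2_inf (Suc n)" "\<And>q. u (face_y c q) $ 2 = f q"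
    using U2_inf_extend[OF f, of c] 2 by metis
  then show ?thesis
    using 2 by (intro that[of "\<lambda>p. swap3 (u (swap3 p))"] U2_inf_swap) auto
qed

text \<open>Both sides consist of functions that are \<open>undefined\<close> off the face, so
  equality as total functions reduces to agreement on the face.\<close>

lemma image_eq_on_face:
  assumes "\<And>u q. q \<notin> face_dom F \<Longrightarrow> tr u q = undefined"
    and "\<And>u. u \<in> U \<Longrightarrow> tr u \<in> agreeing (face_dom F) A"
    and "\<And>g. g \<in> A \<Longrightarrow> \<exists>u\<in>U. \<forall>q\<in>face_dom F. tr u q = g q"
  shows "tr ` U = on_face F A"
proof (intro equalityI subsetI)
  fix t assume "t \<in> tr ` U"
  then obtain u where u: "u \<in> U" "t = tr u" by blast
  obtain g where "g \<in> A" "\<And>q. q \<in> face_dom F \<Longrightarrow> tr u q = g q"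
    using agreeingE[OF assms(2)[OF u(1)]] by blast
  moreover from this have "t = restrict g (face_dom F)"
    using assms(1) by (auto simp: u(2) restrict_def)
  ultimately show "t \<in> on_face F A"
    unfolding on_face_def by blast
next
  fix t assume "t \<in> on_face F A"
  then obtain g where g: "g \<in> A" "t = restrict g (face_dom F)"
    unfolding on_face_def by blast
  obtain u where "u \<in> U" "\<And>q. q \<in> face_dom F \<Longrightarrow> tr u q = g q"
    using assms(3)[OF g(1)] by blast
  moreover from this have "t = tr u"
    using assms(1) by (auto simp: g(2) restrict_def)
  ultimately show "t \<in> tr ` U" by blast
qed

section \<open>Equality of the trace spaces with \<tau> and \<sigma>\<close>

lemma trace_undefined:
  "q \<notin> face_dom F \<Longrightarrow> trace0 F u q = undefined"
  "q \<notin> face_dom F \<Longrightarrow> trace1 F E q = undefined"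
  "q \<notin> face_dom F \<Longrightarrow> trace2 F E q = undefined"
  by (simp_all add: trace0_def trace1_def trace2_def)

lemma trace0_vertical:
  assumes F: "F \<in> {S1, S2, S3, S4}" and "k \<ge> 1"
  shows "trace0 F ` U0 k = on_face F (tau0 k)"
proof (rule image_eq_on_face)
  fix u assume "u \<in> U0 k"
  then have "(\<lambda>q. pullback0 u (inf_chart F q)) \<in> agreeing inf_face (P2w k (int k))"
    unfolding U0_def by (intro U_inf_faces(1)[OF F]) simp
  then have "(\<lambda>q. trace0 F u (phi2 q)) \<in> agreeing inf_face (P2w k (int k))"
    by (subst agreeing_cong) (auto simp: trace0_phi2[OF F])
  then show "trace0 F u \<in> agreeing (face_dom F) (tau0 k)"
    unfolding agreeing_P2_phi2 face_dom_vertical[OF F] tau0_def .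
next
  fix g assume "g \<in> tau0 k"
  then obtain p where p: "p \<in> P2 (int k)" "\<And>q. q \<in> inf_face \<Longrightarrow> g (phi2 q) = p q / (1 + q$2) ^ k"
    unfolding tau0_def using P2_phi2[of g k] by blast
  obtain w where w: "w \<in> U0_inf k" "\<And>q. w (inf_chart F q) = p q / (1 + q$2) ^ k"
    using U0_inf_surj_face[OF F P2wI[OF p(1)] assms(2)] by blast
  obtain u where u: "u \<in> U0 k" "\<And>p. p \<in> Omega_inf \<Longrightarrow> pullback0 u p = w p"
    using U0_of_inf[OF w(1)] by blast
  have "trace0 F u (phi2 q) = g (phi2 q)" if "q \<in> inf_face" for q
    using u(2) w(2) p(2) that by (simp add: trace0_phi2[OF F] inf_chart_vertical[OF F])
  then show "\<exists>u\<in>U0 k. \<forall>q\<in>face_dom F. trace0 F u q = g q"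
    unfolding face_dom_vertical[OF F] phi2_image[symmetric] using u(1) by blast
qed (rule trace_undefined)

lemma trace1_vertical:
  assumes F: "F \<in> {S1, S2, S3, S4}"
  shows "trace1 F ` U1 (Suc n) = on_face F (tau1 q0 (Suc n))"
proof (rule image_eq_on_face)
  fix u assume "u \<in> U1 (Suc n)"
  then have "(\<lambda>q. inf_tangent F (pullback1 u (inf_chart F q))) \<in> agreeing inf_face (U1_face (Suc n))"
    unfolding U1_def by (intro U_inf_faces(2)[OF F]) simp
  then have "(\<lambda>q. vector [trace1 F u (phi2 q) $ 1 / (1 + q$2),
      (trace1 F u (phi2 q) $ 2 - q$1 * trace1 F u (phi2 q) $ 1) / (1 + q$2)\<^sup>2])
      \<in> agreeing inf_face (U1_face (Suc n))"
    by (subst agreeing_cong) (auto simp: trace1_phi2[OF F])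
  then show "trace1 F u \<in> agreeing (face_dom F) (tau1 q0 (Suc n))"
    unfolding agreeing_tau1_phi2[of _ n q0] face_dom_vertical[OF F] .
next
  fix g assume "g \<in> tau1 q0 (Suc n)"
  note g = agreeing_self[OF this, of fin_face, folded agreeing_tau1_phi2]
  obtain f where f: "f \<in> U1_face (Suc n)" "\<And>q. q \<in> inf_face \<Longrightarrow>
      vector [g (phi2 q) $ 1 / (1 + q$2), (g (phi2 q) $ 2 - q$1 * g (phi2 q) $ 1) / (1 + q$2)\<^sup>2] = f q"
    by (rule agreeingE[OF g], rule that)
  obtain w where w: "w \<in> U1_inf (Suc n)" "\<And>q. inf_tangent F (w (inf_chart F q)) = f q"
    using U1_inf_surj_face[OF F f(1)] by blast
  obtain u where u: "u \<in> U1 (Suc n)" "\<And>p. p \<in> Omega_inf \<Longrightarrow> pullback1 u p = w p"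
    using U1_of_inf[OF w(1)] by blast
  have "trace1 F u (phi2 q) = g (phi2 q)" if q: "q \<in> inf_face" for q
  proof -
    define t where "t = trace1 F u (phi2 q)"
    have nz: "1 + q$2 \<noteq> 0"
      using q by (auto simp: inf_face_def)
    have "inf_tangent F (pullback1 u (inf_chart F q)) = f q"
      using u(2) w(2) inf_chart_vertical(1)[OF F q] by simp
    \<comment> \<open>The pulled-back components are triangular in \<open>t\<close> with nonzero
      diagonal factors 1/(1+z) and 1/(1+z)^2, so \<open>t\<close> can be recovered from
      them.\<close>
    then have "vector [t$1 / (1 + q$2), (t$2 - q$1 * t$1) / (1 + q$2)\<^sup>2] =
        (vector [g (phi2 q) $ 1 / (1 + q$2), (g (phi2 q) $ 2 - q$1 * g (phi2 q) $ 1) / (1 + q$2)\<^sup>2] :: real^2)"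
      unfolding trace1_phi2[OF F q] f(2)[OF q] t_def .
    then show ?thesis
      using nz unfolding t_def[symmetric] by (auto simp: vec2_eq_iff)
  qed
  then show "\<exists>u\<in>U1 (Suc n). \<forall>q\<in>face_dom F. trace1 F u q = g q"
    unfolding face_dom_vertical[OF F] phi2_image[symmetric] using u(1) by blast
qed (rule trace_undefined)

lemma trace2_vertical:
  assumes F: "F \<in> {S1, S2, S3, S4}"
  shows "trace2 F ` U2 (Suc n) = on_face F (tau2 (Suc n))"
proof (rule image_eq_on_face)
  fix u assume "u \<in> U2 (Suc n)"
  then have "(\<lambda>q. inf_normal F (pullback2 u (inf_chart F q))) \<in> agreeing inf_face (P2w (Suc n + 2) (int (Suc n) - 1))"
    unfolding U2_def by (intro U_inf_faces(3)[OF F]) simp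
  then obtain f where f: "f \<in> P2 (int n)"
    "\<And>q. q \<in> inf_face \<Longrightarrow> inf_normal F (pullback2 u (inf_chart F q)) = f q / (1 + q$2) ^ (n + 3)"
    unfolding agreeing_def P2w_def by (auto simp: eval_nat_numeral)
  \<comment> \<open>Of the n + 3 powers in the denominator three belong to the Jacobian determinant;
    the other n match the degree bound of \<open>f\<close>.\<close>
  have "trace2 F u (phi2 q) = f q / (1 + q$2) ^ n" if q: "q \<in> inf_face" for q
  proof -
    have "1 + q$2 \<noteq> 0"
      using q by (auto simp: inf_face_def)
    then show ?thesis
      using f(2)[OF q] unfolding trace2_phi2[OF F q] by (simp add: power_add field_simps)
  qed
  then have "(\<lambda>q. trace2 F u (phi2 q)) \<in> agreeing inf_face (P2w n (int n))"
    by (rule agreeingI[OF P2wI[OF f(1)]])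
  then show "trace2 F u \<in> agreeing (face_dom F) (tau2 (Suc n))"
    unfolding agreeing_P2_phi2 face_dom_vertical[OF F] tau2_def by simp
next
  fix g assume "g \<in> tau2 (Suc n)"
  then obtain p where p: "p \<in> P2 (int n)" "\<And>q. q \<in> inf_face \<Longrightarrow> g (phi2 q) = p q / (1 + q$2) ^ n"
    unfolding tau2_def using P2_phi2[of g n] by auto
  obtain w where w: "w \<in> U2_inf (Suc n)" "\<And>q. inf_normal F (w (inf_chart F q)) = p q / (1 + q$2) ^ (n + 3)"
    using U2_inf_surj_face[OF F P2wI[OF p(1)]] by blast
  obtain u where u: "u \<in> U2 (Suc n)" "\<And>p. p \<in> Omega_inf \<Longrightarrow> pullback2 u p = w p"
    using U2_of_inf[OF w(1)] by blast
  have "trace2 F u (phi2 q) = g (phi2 q)" if q: "q \<in> inf_face" for q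
  proof -
    have "1 + q$2 \<noteq> 0"
      using q by (auto simp: inf_face_def)
    moreover have "trace2 F u (phi2 q) / (1 + q$2) ^ 3 = p q / (1 + q$2) ^ (n + 3)"
      using u(2) w(2) inf_chart_vertical(1)[OF F q] trace2_phi2[OF F q, of u] by simp
    ultimately show ?thesis
      by (simp add: p(2)[OF q] power_add field_simps)
  qed
  then show "\<exists>u\<in>U2 (Suc n). \<forall>q\<in>face_dom F. trace2 F u q = g q"
    unfolding face_dom_vertical[OF F] phi2_image[symmetric] using u(1) by blast
qed (rule trace_undefined)

lemma trace0_Base:
  assumes "k \<ge> 1"
  shows "trace0 Base ` U0 k = on_face Base (sigma0 k)"
proof (rule image_eq_on_face)
  fix u assume "u \<in> U0 k"
  then have "pullback0 u \<in> U0_inf k"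
    by (simp add: U0_def)
  then obtain g where g: "g \<in> Q2 (int k) (int k)"
    "\<And>q. q \<in> face_dom Base \<Longrightarrow> pullback0 u (inf_chart Base q) = g q"
    using U0_inf_base[OF _ assms] by blast
  show "trace0 Base u \<in> agreeing (face_dom Base) (sigma0 k)"
    unfolding sigma0_def by (rule agreeingI[OF g(1)]) (simp only: trace_Base(1) g(2))
next
  fix g assume "g \<in> sigma0 k"
  then obtain w where w: "w \<in> U0_inf k" "\<And>q. w (inf_chart Base q) = g q"
    unfolding sigma0_def using U0_inf_base_extend[OF _ assms] by blast
  obtain u where u: "u \<in> U0 k" "\<And>p. p \<in> Omega_inf \<Longrightarrow> pullback0 u p = w p"
    using U0_of_inf[OF w(1)] by blast
  then show "\<exists>u\<in>U0 k. \<forall>q\<in>face_dom Base. trace0 Base u q = g q"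
    by (intro bexI[of _ u] ballI) (simp only: trace_Base(1) inf_chart_Base_in_Omega_inf w(2))
qed (rule trace_undefined)

lemma trace1_Base: "trace1 Base ` U1 (Suc n) = on_face Base (sigma1 (Suc n))"
proof (rule image_eq_on_face)
  fix u assume "u \<in> U1 (Suc n)"
  then have u: "pullback1 u \<in> U1_inf (Suc n)"
    by (simp add: U1_def)
  obtain g where g: "g \<in> sigma1 (Suc n)" "\<And>q. q \<in> face_dom Base \<Longrightarrow>
      vector [pullback1 u (inf_chart Base q) $ 1, pullback1 u (inf_chart Base q) $ 2] = g q"
    by (rule U1_inf_base[OF u], rule that)
  show "trace1 Base u \<in> agreeing (face_dom Base) (sigma1 (Suc n))"
    by (rule agreeingI[OF g(1)]) (simp only: trace_Base(2) inf_tangent.simps g(2))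
next
  fix g assume g: "g \<in> sigma1 (Suc n)"
  obtain w where w: "w \<in> U1_inf (Suc n)"
    "\<And>q. vector [w (inf_chart Base q) $ 1, w (inf_chart Base q) $ 2] = g q"
    by (rule U1_inf_base_extend[OF g], rule that)
  obtain u where u: "u \<in> U1 (Suc n)" "\<And>p. p \<in> Omega_inf \<Longrightarrow> pullback1 u p = w p"
    using U1_of_inf[OF w(1)] by blast
  then show "\<exists>u\<in>U1 (Suc n). \<forall>q\<in>face_dom Base. trace1 Base u q = g q"
    by (intro bexI[of _ u] ballI)
      (simp only: trace_Base(2) inf_tangent.simps inf_chart_Base_in_Omega_inf w(2))
qed (rule trace_undefined)

lemma trace2_Base: "trace2 Base ` U2 (Suc n) = on_face Base (sigma2 (Suc n))"
proof (rule image_eq_on_face)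
  fix u assume "u \<in> U2 (Suc n)"
  then have "pullback2 u \<in> U2_inf (Suc n)"
    by (simp add: U2_def)
  then obtain g where g: "g \<in> Q2 (int n) (int n)"
    "\<And>q. q \<in> face_dom Base \<Longrightarrow> pullback2 u (inf_chart Base q) $ 3 = g q"
    using U2_inf_base by blast
  then have "g \<in> sigma2 (Suc n)"
    by (simp add: sigma2_def)
  then show "trace2 Base u \<in> agreeing (face_dom Base) (sigma2 (Suc n))"
    by (rule agreeingI) (simp only: trace_Base(3) inf_normal.simps g(2))
next
  fix g assume "g \<in> sigma2 (Suc n)"
  then have "g \<in> Q2 (int n) (int n)"
    by (simp add: sigma2_def)
  then obtain w where w: "w \<in> U2_inf (Suc n)" "\<And>q. w (inf_chart Base q) $ 3 = g q"
    using U2_inf_base_extend by blast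
  obtain u where u: "u \<in> U2 (Suc n)" "\<And>p. p \<in> Omega_inf \<Longrightarrow> pullback2 u p = w p"
    using U2_of_inf[OF w(1)] by blast
  then show "\<exists>u\<in>U2 (Suc n). \<forall>q\<in>face_dom Base. trace2 Base u q = g q"
    by (intro bexI[of _ u] ballI)
      (simp only: trace_Base(3) inf_normal.simps inf_chart_Base_in_Omega_inf w(2))
qed (rule trace_undefined)

theorem lemma4p12:
  fixes k :: nat and q0 :: "real^2"
  assumes "k \<ge> 1"
  shows "(\<forall>F\<in>{S1, S2, S3, S4}.
            trace0 F ` U0 k = on_face F (tau0 k) \<and>
            trace1 F ` U1 k = on_face F (tau1 q0 k) \<and>
            trace2 F ` U2 k = on_face F (tau2 k)) \<and>
         trace0 Base ` U0 k = on_face Base (sigma0 k) \<and>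
         trace1 Base ` U1 k = on_face Base (sigma1 k) \<and>
         trace2 Base ` U2 k = on_face Base (sigma2 k)"
proof -
  obtain n where k: "k = Suc n"
    using assms by (cases k) auto
  show ?thesis
    unfolding k
    by (intro conjI ballI trace0_vertical trace1_vertical trace2_vertical
        trace0_Base trace1_Base trace2_Base) auto
qed

end
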